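(* Let $n\geq 1$ be an integer and let $T_n$ be the triphenylene chain with $4n$ hexagons. Let $I,J,K\in\mathbb{Z}[x,y]$ be $I=y^4+y^3x^4+3y^3x^3+4y^3x^2+4y^3x+3y^3+3y^2x^7+9y^2x^6+15y^2x^5+20y^2x^4+21y^2x^3+15y^2x^2+9y^2x+3y^2+2yx^{11}+8yx^{10}+18yx^9+32yx^8+46yx^7+53yx^6+52yx^5+43yx^4+28yx^3+15yx^2+6yx+y+x^{15}+4x^{14}+10x^{13}+20x^{12}+33x^{11}+46x^{10}+56x^9+60x^8+56x^7+46x^6+33x^5+20x^4+10x^3+4x^2+x$, $J=x^4(y^3+y^2x^4+3y^2x^3+3y^2x^2+3y^2x+2y^2+yx^8+4yx^7+7yx^6+10yx^5+12yx^4+10yx^3+7yx^2+4yx+y+x^{12}+3x^{11}+6x^{10}+10x^9+14x^8+16x^7+16x^6+14x^5+10x^4+6x^3+3x^2+x)$, $K=x^8(y+x+(x^4+x^3+x^2+x+y)^2+x^2+x^3+x^4+x^5+x^6+x^7+x^8+x^9)$, and put \begin{align*} A&=\frac{y((x-1)I-J)}{xy-x-y}, & C&=\frac{y((x-1)(I+J)-(J+K))}{xy-x-y},\\ B&=\frac{(y-1)J-I}{xy-x-y}, & D&=\frac{(y-1)(J+K)-(I+J)}{xy-x-y}, \end{align*} $$\lambda_{1,2}=\frac{A+D\pm\sqrt{(A-D)^2+4BC}}{2}.$$ Then the Tutte polynomial $T(T_n)=T(T_n;x,y)$ satisfies $$T(T_n)=(I+2J+K)\frac{\lambda^n_1-\lambda^n_2}{\lambda_1-\lambda_2}+\big(C(I+J)-A(I+2J+K)\big)\frac{\lambda^{n-1}_1-\lambda^{n-1}_2}{\lambda_1-\lambda_2},$$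 and equivalently \begin{align*} T(T_n)=&(I+2J+K)\sum_{j=0}^{\lfloor \frac{n-1}{2}\rfloor}\binom{n-j-1}{j}(A+D)^{n-2j-1}(BC-AD)^{j}\\ &+\big(C(I+J)-A(I+2J+K)\big)\sum_{j=0}^{\lfloor \frac{n-2}{2}\rfloor}\binom{n-j-2}{j}(A+D)^{n-2j-2}(BC-AD)^{j}. \end{align*}
   Context: The Tutte polynomial of a finite graph $G=(V,E)$ (loops and multiple edges allowed) is $T(G;x,y)=\sum_{S\subseteq E}(x-1)^{r(E)-r(S)}(y-1)^{|S|-r(S)}$, where $r(S)=|V|-\omega(V,S)$ and $\omega(V,S)$ is the number of connected components of $(V,S)$. A benzenoid system is a finite connected plane graph without cut vertices in which every interior face is bounded by a regular hexagon of side length $1$; it is catacondensed if no three hexagons share a common vertex. Two hexagons are adjacent if they share an edge. The triphenylene chain $T_n$ is a catacondensed benzenoid system with $4n$ hexagons $c_i,u_i,w_i,b_i$ ($1\le i\le n$), formed by $n$ triphenylene units (unit $i$ being a central hexagon $c_i$ with three pairwise non-adjacent hexagons $u_i,w_i,b_i$ each adjacent to $c_i$), where consecutive units are fused by letting $w_i$ and $u_{i+1}$ share an edge. The adjacent pairs are exactly $c_iu_i,\ c_iw_i,\ c_ib_i$ ($1\le i\le n$) and $w_iu_{i+1}$ ($1\le i\le n-1$). Only the planar dual of $T_n$ is relevant: it has vertices $c_i,u_i,w_i,b_i$ and $v$ (the outer face), one edge for each adjacent pair listed, and edges to $v$ with multiplicity $3$ from each $c_i$, $5$ from each $b_i$,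 and $4$ from each $u_i$ and $w_i$, except that $u_1$ and $w_n$ are joined to $v$ with multiplicity $5$. Identities are between elements of an algebraic closure of $\mathbb{Q}(x,y)$; empty sums are $0$. *)

theory Defs
  imports
    "HOL-Library.Product_Plus"
    "HOL-Computational_Algebra.Polynomial"
    "HOL-Computational_Algebra.Fraction_Field"
    "HOL-Algebra.Algebraic_Closure_Type"
begin

section \<open>Finite multigraphs and the Tutte polynomial\<close>

text \<open>
  An edge is an abstract object, so parallel edges are allowed; its set of end vertices has one
  element for a loop and two elements otherwise.
\<close>

record ('v, 'e) multigraph =
  verts :: "'v set"
  edges :: "'e set"
  ends :: "'e \<Rightarrow> 'v set"

definition reachable :: "('v, 'e) multigraph \<Rightarrow> 'e set \<Rightarrow> ('v \<times> 'v) set" where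
  "reachable G S =
     {(a, b). a \<in> verts G \<and> b \<in> verts G \<and> (a, b) \<in> {(p, q). \<exists>e\<in>S. ends G e = {p, q}}\<^sup>*}"

definition num_components :: "('v, 'e) multigraph \<Rightarrow> 'e set \<Rightarrow> nat" where
  "num_components G S = card (verts G // reachable G S)"

definition rank :: "('v, 'e) multigraph \<Rightarrow> 'e set \<Rightarrow> nat" where
  "rank G S = card (verts G) - num_components G S"

text \<open>
  The subtractions of natural numbers below do not truncate for a finite graph, because
  \<open>num_components G S \<le> card (verts G)\<close>, \<open>rank G S \<le> rank G (edges G)\<close> and
  \<open>rank G S \<le> card S\<close>.
\<close>

definition tutte :: "('v, 'e) multigraph \<Rightarrow> 'a::comm_ring_1 \<Rightarrow> 'a \<Rightarrow> 'a" where
  "tutte G x y =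
     (\<Sum>S\<in>Pow (edges G). (x - 1) ^ (rank G (edges G) - rank G S) * (y - 1) ^ (card S - rank G S))"

definition connected_graph :: "('v, 'e) multigraph \<Rightarrow> bool" where
  "connected_graph G \<longleftrightarrow> num_components G (edges G) = 1"

definition delete_vertex :: "('v, 'e) multigraph \<Rightarrow> 'v \<Rightarrow> ('v, 'e) multigraph" where
  "delete_vertex G v = \<lparr>verts = verts G - {v}, edges = {e \<in> edges G. v \<notin> ends G e}, ends = ends G\<rparr>"

text \<open>This is the usual notion for a connected graph with at least two vertices; it is used only there.\<close>

definition cut_vertex :: "('v, 'e) multigraph \<Rightarrow> 'v \<Rightarrow> bool" where
  "cut_vertex G v \<longleftrightarrow> v \<in> verts G \<and> \<not> connected_graph (delete_vertex G v)"


section \<open>The hexagonal lattice\<close>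

text \<open>
  The pair \<open>(a, b)\<close> stands for the point \<open>a + b\<omega>\<close> of the plane, where
  \<open>\<omega> = exp (2\<pi>i/3)\<close>. The points at distance 1 from 0 are, in cyclic order,
  \<open>1, 1 + \<omega>, \<omega>, -1, -1 - \<omega>, -\<omega>\<close>. The points with \<open>a + b\<close> divisible by 3 are the centres of the
  hexagons of a tiling of the plane by regular hexagons of side length 1; the other points are
  the vertices of the tiling. A hexagon is represented by its centre.
\<close>

type_synonym point = "int \<times> int"

definition unit_vectors :: "point set" where
  "unit_vectors = {(1, 0), (1, 1), (0, 1), (-1, 0), (-1, -1), (0, -1)}"

definition hexagons :: "point set" where
  "hexagons = {p. 3 dvd fst p + snd p}"

definition corners :: "point \<Rightarrow> point set" where
  "corners p = {p + d | d. d \<in> unit_vectors}"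

definition sides :: "point \<Rightarrow> point set set" where
  "sides p = {{q, r} | q r. q \<in> corners p \<and> r \<in> corners p \<and> r - q \<in> unit_vectors}"

definition adjacent :: "point \<Rightarrow> point \<Rightarrow> bool" where
  "adjacent p q \<longleftrightarrow> p \<noteq> q \<and> sides p \<inter> sides q \<noteq> {}"

text \<open>The plane graph formed by the corners and sides of the hexagons in \<open>H\<close>.\<close>

definition hex_graph :: "point set \<Rightarrow> (point, point set) multigraph" where
  "hex_graph H = \<lparr>verts = (\<Union>p\<in>H. corners p), edges = (\<Union>p\<in>H. sides p), ends = (\<lambda>e. e)\<rparr>"


section \<open>Benzenoid systems\<close>

text \<open>
  In a plane graph without cut vertices whose interior faces are all bounded by regular hexagons
  of side length 1, these hexagons are cells of one hexagonal tiling, and every vertex and every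
  edge lies on one of them. So a benzenoid system is given by the set \<open>H\<close> of its hexagons. Passing
  from a tile outside \<open>H\<close> to an adjacent tile outside \<open>H\<close> crosses no edge of the graph. Hence
  the last condition, that the tiles outside \<open>H\<close> are connected to each other by such steps, says
  that they together form the outer face, that is, that the interior faces are exactly the members
  of \<open>H\<close>.
\<close>

definition benzenoid_system :: "point set \<Rightarrow> bool" where
  "benzenoid_system H \<longleftrightarrow>
     finite H \<and> H \<noteq> {} \<and> H \<subseteq> hexagons \<and>
     connected_graph (hex_graph H) \<and>
     (\<forall>v. \<not> cut_vertex (hex_graph H) v) \<and>
     (\<forall>p\<in>hexagons - H. \<forall>q\<in>hexagons - H.
        (p, q) \<in> {(a, b). a \<in> hexagons - H \<and> b \<in> hexagons - H \<and> adjacent a b}\<^sup>*)"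

definition catacondensed :: "point set \<Rightarrow> bool" where
  "catacondensed H \<longleftrightarrow>
     (\<forall>p\<in>H. \<forall>q\<in>H. \<forall>r\<in>H. p \<noteq> q \<and> p \<noteq> r \<and> q \<noteq> r \<longrightarrow> corners p \<inter> corners q \<inter> corners r = {})"


section \<open>Triphenylene chains\<close>

text \<open>The hexagons \<open>c\<^sub>i, u\<^sub>i, w\<^sub>i, b\<^sub>i\<close> of unit \<open>i\<close> are named \<open>(Hex_c, i)\<close>, \<open>(Hex_u, i)\<close>, etc.\<close>

datatype hex_kind = Hex_c | Hex_u | Hex_w | Hex_b

inductive fused :: "hex_kind \<times> nat \<Rightarrow> hex_kind \<times> nat \<Rightarrow> bool" where
  "fused (Hex_c, i) (Hex_u, i)"
| "fused (Hex_c, i) (Hex_w, i)"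
| "fused (Hex_c, i) (Hex_b, i)"
| "fused (Hex_w, i) (Hex_u, Suc i)"

text \<open>
  The adjacencies do not determine \<open>H\<close> up to congruence: there are several choices for the side of
  \<open>w\<^sub>i\<close> that is shared with \<open>u\<^sub>i\<^sub>+\<^sub>1\<close>, and for which of the neighbours of \<open>c\<^sub>i\<close> is \<open>b\<^sub>i\<close>. The predicate
  holds for all of them. They have the same planar dual: a hexagon is joined to the outer face
  by six edges minus the number of adjacent hexagons.
\<close>

definition triphenylene_chain :: "nat \<Rightarrow> point set \<Rightarrow> bool" where
  "triphenylene_chain n H \<longleftrightarrow>
     benzenoid_system H \<and> catacondensed H \<and>
     (\<exists>h. bij_betw h (UNIV \<times> {1..n}) H \<and>
        (\<forall>s\<in>UNIV \<times> {1..n}. \<forall>t\<in>UNIV \<times> {1..n}. adjacent (h s) (h t) \<longleftrightarrow> fused s t \<or> fused t s))"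


section \<open>The coefficient field\<close>

text \<open>
  \<open>rat poly poly\<close> is the ring \<open>\<rat>[x][y]\<close>, with \<open>x\<close> the indeterminate of the inner and \<open>y\<close> that of
  the outer polynomials.
\<close>

type_synonym Qxy_closure = "rat poly poly fract alg_closure"

definition var_x :: Qxy_closure where
  "var_x = to_ac (Fract [:[:0, 1:]:] 1)"

definition var_y :: Qxy_closure where
  "var_y = to_ac (Fract [:0, 1:] 1)"

end

theory Submission
  imports Defs
begin

text \<open>
  The cycle matroid of the chain is built by gluing one hexagon after the other along a single edge,
  and the proof follows this construction with a transfer matrix.

  Every edge e carries two weights, b e for edges in the chosen subset S and a e for edges outside it;
  \<open>weighted_tutte\<close> is the resulting weighted sum over S, and plain edges have both weights 1. Glue a
  path P of new edges with new inner vertices to the end vertices of an edge e. Summing over the part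
  of S inside P leaves a sum over the old graph, because either all of P is chosen, and P connects the
  ends of e as e itself does, or some edge of P is missing, and then P does not affect the connectivity
  of the rest. So P is absorbed by changing the two weights of e, and this change is linear in the
  weights of P at each of its edges (\<open>weighted_tutte_attach_ear\<close>).

  In the hexagonal lattice two distinct hexagons with a common corner have exactly one side in common. Hence a
  hexagon adjacent to a single member of H meets H in this one side, and the other five sides form a
  path P as above (\<open>hex_tutte_leaf\<close>). In the last unit of the chain this removes w, b, c and u, in this
  order. The pair of weights on one outer side of w turns into a pair of weights on the side which u
  shares with the preceding unit, by a linear map \<open>unit_ear\<close> with a 2 by 2 matrix M over \<open>\<int>[x,y]\<close>. The
  first unit counts as glued onto a single edge, whose Tutte polynomial is x, so that
  \<open>T(T\<^sub>n) = \<ell> (M\<^sup>n (1, 1))\<close> with \<open>\<ell> (a, b) = (x - 1) a + b\<close> and the value x for n = 0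
  (\<open>tutte_triphenylene_chain\<close>). By the Cayley-Hamilton theorem these values satisfy the linear
  recurrence whose coefficients are the trace t and the negated determinant d of M.

  It remains to compare t, d and \<open>T(T\<^sub>1)\<close> with I, J, K and A, B, C, D. With w = xy - x - y, expanding the
  entries of M gives \<open>T(T\<^sub>1) = I + 2J + K\<close>, \<open>t w = (xy - y - 1) I - 2J + (y - 1) K\<close> and
  \<open>d w = y (I K - J\<^sup>2)\<close>. This means t = A + D and d = A D - B C, and it makes the coefficient
  C(I + J) - A(I + 2J + K) equal to -d x, which is what the initial values x and \<open>T(T\<^sub>1)\<close> require. The
  sum with binomial coefficients and the quotient of differences of powers are both the solution
  of this recurrence with initial values 1 and t. The quotient makes sense since
  \<open>s\<^sup>2 = t\<^sup>2 - 4 d\<close> has the value 1 at x = y = 0, so that \<open>\<lambda>\<^sub>1 \<noteq> \<lambda>\<^sub>2\<close>.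
\<close>

section \<open>Connected components of edge sets\<close>

definition links :: "'v set set \<Rightarrow> ('v \<times> 'v) set" where
  "links R = {(p, q). {p, q} \<in> R}\<^sup>*"

text \<open>
  For graphs whose edges are the sets of their end vertices this is \<open>reachable\<close>, stated
  for a vertex set and an edge set so that both may vary.
\<close>

definition connection :: "'v set \<Rightarrow> 'v set set \<Rightarrow> ('v \<times> 'v) set" where
  "connection V R = links R \<inter> V \<times> V"

definition comps :: "'v set \<Rightarrow> 'v set set \<Rightarrow> nat" where
  "comps V R = card (V // connection V R)"

lemma links_refl [simp]: "(p, p) \<in> links R"
  by (simp add: links_def)

lemma links_sym: "(p, q) \<in> links R \<Longrightarrow> (q, p) \<in> links R"
proof -
  have "sym {(p, q). {p, q} \<in> R}"
    by (auto simp: sym_def insert_commute)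
  then show "(p, q) \<in> links R \<Longrightarrow> (q, p) \<in> links R"
    unfolding links_def by (metis sym_rtrancl symD)
qed

lemma links_trans: "(p, q) \<in> links R \<Longrightarrow> (q, r) \<in> links R \<Longrightarrow> (p, r) \<in> links R"
  unfolding links_def by (rule rtrancl_trans)

lemma links_edge: "{p, q} \<in> R \<Longrightarrow> (p, q) \<in> links R"
  unfolding links_def by auto

text \<open>
  A map of the vertices which sends the ends of each edge to connected vertices preserves
  connectedness. Contracting a path and adding or dropping redundant edges are instances of this.
\<close>

lemma links_map:
  assumes "(p, q) \<in> links R" and "\<And>s t. {s, t} \<in> R \<Longrightarrow> (f s, f t) \<in> links R'"
  shows "(f p, f q) \<in> links R'"
  using assms(1) unfolding links_def[of R]
proof (induction rule: rtrancl_induct)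
  case base
  show ?case by simp
next
  case (step s t)
  then show ?case using assms(2)[of s t] by (auto intro: links_trans)
qed

lemma links_mono:
  assumes "R \<subseteq> R'"
  shows "links R \<subseteq> links R'"
proof (rule subrelI)
  show "(p, q) \<in> links R'" if "(p, q) \<in> links R" for p q
    using that by (rule links_map[where f="\<lambda>v. v"]) (use assms in \<open>auto intro: links_edge\<close>)
qed

lemma equiv_connection: "equiv V (connection V R)"
  by (rule equivI)
    (auto simp: connection_def refl_on_def sym_def trans_def intro: links_sym links_trans)

lemma finite_classes: "finite V \<Longrightarrow> finite (V // connection V R)"
  by (simp add: finite_quotient connection_def)

lemma comps_le_card: "finite V \<Longrightarrow> comps V R \<le> card V"
  unfolding comps_def quotient_def by (simp add: UNION_singleton_eq_range card_image_le)

lemma comps_pos: "finite V \<Longrightarrow> V \<noteq> {} \<Longrightarrow> 0 < comps V R"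
  unfolding comps_def by (simp add: card_gt_0_iff finite_classes quotient_is_empty)

lemma num_components_eq_comps:
  assumes "ends G = (\<lambda>e. e)"
  shows "num_components G S = comps (verts G) S"
proof -
  have "{(p, q). \<exists>e\<in>S. ends G e = {p, q}} = {(p, q). {p, q} \<in> S}"
    using assms by auto
  then show ?thesis
    unfolding num_components_def comps_def reachable_def connection_def links_def
    by (auto intro!: arg_cong[where f=card] arg_cong2[where f=quotient])
qed

text \<open>
  Intersection with V is a bijection from the classes on V' to the classes on V.
\<close>

lemma comps_transfer:
  assumes sub: "V \<subseteq> V'"
    and meets: "\<And>p. p \<in> V' \<Longrightarrow> \<exists>q\<in>V. (p, q) \<in> links R'"
    and restr: "\<And>p q. p \<in> V \<Longrightarrow> q \<in> V \<Longrightarrow> (p, q) \<in> links R' \<longleftrightarrow> (p, q) \<in> links R"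
  shows "comps V' R' = comps V R"
proof -
  let ?r = "connection V R" and ?r' = "connection V' R'"
  have cls: "?r' `` {p} \<inter> V = ?r `` {p}" if "p \<in> V" for p
    using that sub restr by (auto simp: connection_def)
  have rep: "\<exists>p\<in>V. Q = ?r' `` {p}" if Q: "Q \<in> V' // ?r'" for Q
  proof -
    obtain p where p: "p \<in> V'" "Q = ?r' `` {p}" using Q by (auto simp: quotient_def)
    obtain q where q: "q \<in> V" "(p, q) \<in> links R'" using meets p(1) by blast
    have "Q = ?r' `` {q}"
      using p q sub equiv_class_eq[OF equiv_connection, of p q V' R'] by (auto simp: connection_def)
    with q show ?thesis by blast
  qed
  have "bij_betw (\<lambda>Q. Q \<inter> V) (V' // ?r') (V // ?r)"
  proof (rule bij_betw_imageI)
    show "inj_on (\<lambda>Q. Q \<inter> V) (V' // ?r')"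
    proof (rule inj_onI)
      fix Q Q' assume QQ: "Q \<in> V' // ?r'" "Q' \<in> V' // ?r'" and eq: "Q \<inter> V = Q' \<inter> V"
      obtain p q where pq: "p \<in> V" "Q = ?r' `` {p}" "q \<in> V" "Q' = ?r' `` {q}"
        using rep QQ by blast
      have "p \<in> Q \<inter> V" using pq sub by (auto simp: connection_def)
      then have "(q, p) \<in> ?r'" using eq pq by auto
      then show "Q = Q'"
        using pq equiv_class_eq[OF equiv_connection] by metis
    qed
    have "V' // ?r' = (\<lambda>p. ?r' `` {p}) ` V"
      using rep sub by (fastforce intro: quotientI)
    moreover have "V // ?r = (\<lambda>p. ?r `` {p}) ` V" by (auto simp: quotient_def)
    ultimately show "(\<lambda>Q. Q \<inter> V) ` (V' // ?r') = V // ?r"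
      by (simp add: image_image cls)
  qed
  then show ?thesis
    unfolding comps_def by (rule bij_betw_same_card)
qed

lemma comps_isolated:
  assumes "finite V" "z \<notin> V" and "\<And>e. e \<in> R \<Longrightarrow> e \<subseteq> V"
  shows "comps (insert z V) R = Suc (comps V R)"
proof -
  let ?r = "connection V R" and ?r' = "connection (insert z V) R"
  have z: "q = z" if "(z, q) \<in> links R" for q
    using that unfolding links_def
    by (induction rule: rtrancl_induct) (use assms(2,3) in auto)
  have "?r' `` {z} = {z}" using z by (auto simp: connection_def)
  moreover have "?r' `` {p} = ?r `` {p}" if "p \<in> V" for p
    using that z assms(2) links_sym[of p z R] by (auto simp: connection_def)
  ultimately have "insert z V // ?r' = insert {z} (V // ?r)"
    by (auto simp: quotient_def)
  moreover have "{z} \<notin> V // ?r"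
    using assms(2) by (auto simp: quotient_def connection_def)
  ultimately show ?thesis
    unfolding comps_def using finite_classes[OF assms(1)] by simp
qed

text \<open>
  Together with \<open>comps_isolated\<close> and \<open>comps_pendant\<close> this gives the effect
  of the two edges az and zb at an inner vertex z of a path: with both of them z is an inner point
  of a connection from a to b, with one of them z is attached to an existing component, with none it
  is a component of its own.
\<close>

lemma comps_series:
  assumes "z \<notin> V" "a \<in> V" "b \<in> V" and R: "\<And>e. e \<in> R \<Longrightarrow> e \<subseteq> V"
  shows "comps (insert z V) (insert {a, z} (insert {z, b} R)) = comps V (insert {a, b} R)"
proof (rule comps_transfer)
  let ?R' = "insert {a, z} (insert {z, b} R)" and ?R = "insert {a, b} R"
  have ab: "(a, b) \<in> links ?R'"
    by (rule links_trans[of a z]) (auto intro: links_edge)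
  fix p
  show "\<exists>q\<in>V. (p, q) \<in> links ?R'" if "p \<in> insert z V"
  proof (cases "p = z")
    case True
    then show ?thesis using assms(3) by (auto intro!: bexI[of _ b] links_edge)
  qed (use that in \<open>auto intro!: bexI[of _ p]\<close>)
  fix q assume "p \<in> V" "q \<in> V"
  show "(p, q) \<in> links ?R' \<longleftrightarrow> (p, q) \<in> links ?R"
  proof
    assume "(p, q) \<in> links ?R"
    then show "(p, q) \<in> links ?R'"
      by (rule links_map[where f="\<lambda>v. v"])
        (auto simp: doubleton_eq_iff intro: ab links_sym[OF ab] links_edge)
  next
    \<comment> \<open>Identifying z with a turns az into a loop and zb into ab, and fixes all other edges.\<close>
    let ?f = "\<lambda>v. if v = z then a else v"
    assume "(p, q) \<in> links ?R'"
    then have "(?f p, ?f q) \<in> links ?R"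
    proof (rule links_map)
      fix s t assume st: "{s, t} \<in> ?R'"
      show "(?f s, ?f t) \<in> links ?R"
      proof (cases "{s, t} \<in> R")
        case True
        then have "?f s = s" "?f t = t" using R assms(1) by auto
        then show ?thesis using True by (auto intro: links_edge)
      next
        case False
        show ?thesis
        proof -
          have ab: "(a, b) \<in> links ?R" "(b, a) \<in> links ?R"
            by (auto intro: links_edge links_sym)
          have "{s, t} = {a, z} \<or> {s, t} = {z, b}" using st False by blast
          then consider "s = a" "t = z" | "s = z" "t = a" | "s = z" "t = b" | "s = b" "t = z"
            unfolding doubleton_eq_iff by blast
          then show ?thesis
            using assms(1-3) ab by cases auto
        qed
      qed
    qed
    then show "(p, q) \<in> links ?R"
      using \<open>p \<in> V\<close> \<open>q \<in> V\<close> assms(1) by (auto split: if_splits)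
  qed
qed auto

lemma comps_pendant:
  assumes "z \<notin> V" "a \<in> V" and R: "\<And>e. e \<in> R \<Longrightarrow> e \<subseteq> V"
  shows "comps (insert z V) (insert {a, z} R) = comps V R"
proof -
  have "comps (insert z V) (insert {a, z} R) = comps V (insert {a, a} R)"
    using comps_series[OF assms(1,2,2) R] by (simp add: insert_commute)
  also have "\<dots> = comps V R"
  proof (rule comps_transfer)
    show "(p, q) \<in> links (insert {a, a} R) \<longleftrightarrow> (p, q) \<in> links R" for p q
    proof
      assume "(p, q) \<in> links (insert {a, a} R)"
      then show "(p, q) \<in> links R"
        by (rule links_map[where f="\<lambda>v. v"]) (auto intro: links_edge)
    next
      show "(p, q) \<in> links R \<Longrightarrow> (p, q) \<in> links (insert {a, a} R)"
        using links_mono[of R "insert {a, a} R"] by auto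
    qed
  qed (auto intro: links_refl)
  finally show ?thesis .
qed

text \<open>
  A class that survives unchanged in the larger edge set avoids a and b. So passing to the larger
  edge set loses at most the two classes of a and b and gains the class of a.
\<close>

lemma comps_insert_le:
  assumes "finite V" "a \<in> V" "b \<in> V"
  shows "comps V R \<le> Suc (comps V (insert {a, b} R))"
proof -
  let ?R' = "insert {a, b} R"
  let ?r = "connection V R" and ?r' = "connection V ?R'"
  have new: "(p, q) \<in> links R \<or> (p, a) \<in> links R \<or> (p, b) \<in> links R"
    if "(p, q) \<in> links ?R'" for p q
    using that unfolding links_def[of ?R']
  proof (induction rule: rtrancl_induct)
    case (step s t)
    then show ?case
      by (auto simp: doubleton_eq_iff intro: links_trans[OF _ links_edge])
  qed simp
  have old: "links R \<subseteq> links ?R'" by (rule links_mono) auto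
  have "V // ?r \<subseteq> insert (?r `` {a}) (insert (?r `` {b}) (V // ?r' - {?r' `` {a}}))"
  proof
    fix Q assume "Q \<in> V // ?r"
    then obtain p where p: "p \<in> V" "Q = ?r `` {p}" by (auto simp: quotient_def)
    show "Q \<in> insert (?r `` {a}) (insert (?r `` {b}) (V // ?r' - {?r' `` {a}}))"
    proof (cases "(p, a) \<in> links R \<or> (p, b) \<in> links R")
      case True
      then have "Q = ?r `` {a} \<or> Q = ?r `` {b}"
        using p assms equiv_class_eq[OF equiv_connection[of V R]] by (auto simp: connection_def)
      then show ?thesis by auto
    next
      case False
      then have "Q = ?r' `` {p}"
        using p new old by (auto simp: connection_def)
      moreover have "(p, a) \<notin> links ?R'" using False new by blast
      then have "a \<notin> ?r' `` {p}" by (auto simp: connection_def)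
      moreover have "a \<in> ?r' `` {a}" using assms by (auto simp: connection_def)
      ultimately show ?thesis using p by (auto simp: quotient_def)
    qed
  qed
  then have "card (V // ?r) \<le> card (insert (?r `` {a}) (insert (?r `` {b}) (V // ?r' - {?r' `` {a}})))"
    by (rule card_mono[rotated]) (simp add: finite_classes assms)
  also have "\<dots> \<le> Suc (Suc (card (V // ?r' - {?r' `` {a}})))"
    using finite_classes[OF assms(1), of ?R'] by (auto simp: card_insert_if simp del: card_Diff_insert)
  also have "card (V // ?r' - {?r' `` {a}}) = card (V // ?r') - 1"
    using assms finite_classes[OF assms(1)] by (simp add: quotientI)
  also have "0 < card (V // ?r')"
    using comps_pos[OF assms(1)] assms(2) unfolding comps_def by auto
  then have "Suc (Suc (card (V // ?r') - 1)) = Suc (card (V // ?r'))" by simp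
  finally show ?thesis unfolding comps_def .
qed

lemma card_le_comps:
  assumes "finite V" "finite R" and "\<And>e. e \<in> R \<Longrightarrow> \<exists>a\<in>V. \<exists>b\<in>V. e = {a, b}"
  shows "card V \<le> card R + comps V R"
  using assms(2,3)
proof (induction R rule: finite_induct)
  case empty
  have "connection V {} = {(v, v) | v. v \<in> V}" by (auto simp: connection_def links_def)
  then have "V // connection V {} = (\<lambda>v. {v}) ` V" by (auto simp: quotient_def)
  then show ?case by (simp add: comps_def card_image)
next
  case (insert e R)
  then obtain a b where "a \<in> V" "b \<in> V" "e = {a, b}" by blast
  then have "comps V R \<le> Suc (comps V (insert e R))"
    using comps_insert_le[OF assms(1)] by blast
  with insert show ?case by force
qed

section \<open>A weighted Tutte polynomial and attachment of ears\<close>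

lemma sum_Pow_insert:
  assumes "finite E" "e \<notin> E"
  shows "(\<Sum>S\<in>Pow (insert e E). f S) = (\<Sum>S\<in>Pow E. f S + f (insert e S))"
proof -
  have "Pow E \<inter> insert e ` Pow E = {}" "inj_on (insert e) (Pow E)"
    using assms(2) by (auto simp: inj_on_def)
  then show ?thesis
    using assms(1) by (simp add: Pow_insert sum.union_disjoint sum.reindex sum.distrib)
qed

lemma sum_Pow_Un:
  assumes "E \<inter> P = {}"
  shows "(\<Sum>S\<in>Pow (E \<union> P). f S) = (\<Sum>S\<in>Pow E. \<Sum>T\<in>Pow P. f (S \<union> T))"
proof -
  have "bij_betw (\<lambda>(S, T). S \<union> T) (Pow E \<times> Pow P) (Pow (E \<union> P))"
    by (rule bij_betw_byWitness[where f' = "\<lambda>S. (S \<inter> E, S \<inter> P)"]) (use assms in auto)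
  then have "(\<Sum>S\<in>Pow (E \<union> P). f S) = (\<Sum>(S, T)\<in>Pow E \<times> Pow P. f (S \<union> T))"
    by (simp add: sum.reindex_bij_betw[symmetric] case_prod_unfold)
  then show ?thesis by (simp add: sum.cartesian_product)
qed

text \<open>
  Multiplied by y - 1 to the power |S|, this is x - 1 times the summand of the Tutte polynomial at S
  when the graph is connected. The division by a power of y - 1 has the effect that attaching a path
  changes the edge weights only, without producing an extra factor.
\<close>

definition config_weight :: "'a::field \<Rightarrow> 'a \<Rightarrow> 'v set \<Rightarrow> 'v set set \<Rightarrow> 'a" where
  "config_weight x y V S = ((x - 1) * (y - 1)) ^ comps V S / (y - 1) ^ card V"

definition weighted_tutte ::
    "'a::field \<Rightarrow> 'a \<Rightarrow> 'v set \<Rightarrow> 'v set set \<Rightarrow> ('v set \<Rightarrow> 'a) \<Rightarrow> ('v set \<Rightarrow> 'a) \<Rightarrow> 'a" where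
  "weighted_tutte x y V E a b =
     (\<Sum>S\<in>Pow E. config_weight x y V S * (\<Prod>e\<in>S. (y - 1) * b e) * (\<Prod>e\<in>E - S. a e))"

lemma weighted_tutte_cong:
  assumes "\<And>e. e \<in> E \<Longrightarrow> a e = a' e" "\<And>e. e \<in> E \<Longrightarrow> b e = b' e"
  shows "weighted_tutte x y V E a b = weighted_tutte x y V E a' b'"
  unfolding weighted_tutte_def
  by (intro sum.cong prod.cong arg_cong2[where f="(*)"] refl) (use assms in auto)

fun path_edges :: "'v list \<Rightarrow> 'v set set" where
  "path_edges (u # v # vs) = insert {u, v} (path_edges (v # vs))"
| "path_edges _ = {}"

lemma finite_path_edges [simp]: "finite (path_edges vs)"
  by (induction vs rule: path_edges.induct) auto

lemma path_edges_subset: "e \<in> path_edges vs \<Longrightarrow> e \<subseteq> set vs"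
  by (induction vs rule: path_edges.induct) auto

text \<open>
  These are the weights of a path P seen as a single edge between its ends: \<open>ear_on\<close>
  collects the case that all edges of P are chosen, \<open>ear_off\<close> all other cases. Every
  missing edge after the first one splits off a further component, which is worth the factor x - 1.
  So x - 1 times \<open>ear_off\<close> is the product of all (x - 1) a e + b e without the term in
  which no edge is missing.
\<close>

definition ear_on :: "'e set \<Rightarrow> ('e \<Rightarrow> 'a::field) \<Rightarrow> 'a" where
  "ear_on P b = (\<Prod>e\<in>P. b e)"

definition ear_off :: "'a::field \<Rightarrow> 'e set \<Rightarrow> ('e \<Rightarrow> 'a) \<Rightarrow> ('e \<Rightarrow> 'a) \<Rightarrow> 'a" where
  "ear_off x P a b = ((\<Prod>e\<in>P. (x - 1) * a e + b e) - (\<Prod>e\<in>P. b e)) / (x - 1)"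

text \<open>
  Induction along the path: the first inner vertex z is added to the graph together with the edge uz
  or without it, and the rest of the path runs from z to v. The claim is for a fixed edge set R of
  the old graph.
\<close>

lemma sum_over_ear:
  fixes x y :: "'a::field"
  assumes xy: "x \<noteq> 1" "y \<noteq> 1"
    and "finite V" "u \<in> V" "v \<in> V" "u \<noteq> v" "distinct zs" "set zs \<inter> V = {}"
    and "\<And>e. e \<in> R \<Longrightarrow> e \<subseteq> V"
  shows "(\<Sum>S\<in>Pow (path_edges (u # zs @ [v])). config_weight x y (V \<union> set zs) (R \<union> S)
            * (\<Prod>e\<in>S. (y - 1) * b e) * (\<Prod>e\<in>path_edges (u # zs @ [v]) - S. a e))
         = ear_off x (path_edges (u # zs @ [v])) a b * config_weight x y V R
           + (y - 1) * ear_on (path_edges (u # zs @ [v])) b * config_weight x y V (insert {u, v} R)"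
  using assms(3-9)
proof (induction zs arbitrary: V u R)
  case Nil
  have "Pow {{u, v}} = {{}, {{u, v}}}" by auto
  then show ?case using xy by (simp add: ear_off_def ear_on_def field_simps)
next
  case (Cons z zs)
  let ?P = "path_edges (z # zs @ [v])" and ?g = "{u, z}" and ?V = "insert z V"
  let ?N = "ear_off x ?P a b" and ?F = "ear_on ?P b" and ?c = "config_weight x y"
  let ?w = "\<lambda>S. (\<Prod>e\<in>S. (y - 1) * b e) * (\<Prod>e\<in>?P - S. a e)"
  have z: "z \<notin> V" using Cons.prems by auto
  have g: "?g \<notin> ?P"
    using path_edges_subset[of ?g "z # zs @ [v]"] Cons.prems by auto
  have prod_on: "(\<Prod>e\<in>insert ?g S. (y - 1) * b e) = (y - 1) * b ?g * (\<Prod>e\<in>S. (y - 1) * b e)"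
    and prod_off: "(\<Prod>e\<in>insert ?g ?P - S. a e) = a ?g * (\<Prod>e\<in>?P - S. a e)"
    and diff: "insert ?g ?P - insert ?g S = ?P - S"
    if "S \<subseteq> ?P" for S
    using that g finite_subset[OF that]
    by (auto simp: insert_Diff_if prod.insert_if subset_iff intro!: arg_cong[where f="prod a"])
  have VV: "V \<union> set (z # zs) = ?V \<union> set zs" by simp
  have IH: "(\<Sum>S\<in>Pow ?P. ?c (?V \<union> set zs) (R' \<union> S) * ?w S)
      = ?N * ?c ?V R' + (y - 1) * ?F * ?c ?V (insert {z, v} R')"
    if "\<And>e. e \<in> R' \<Longrightarrow> e \<subseteq> ?V" for R'
    using Cons.IH[of ?V z R'] Cons.prems that z by (auto simp: mult.assoc)
  have "(\<Sum>S\<in>Pow (insert ?g ?P). ?c (V \<union> set (z # zs)) (R \<union> S)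
          * (\<Prod>e\<in>S. (y - 1) * b e) * (\<Prod>e\<in>insert ?g ?P - S. a e))
      = (\<Sum>S\<in>Pow ?P. a ?g * (?c (?V \<union> set zs) (R \<union> S) * ?w S)
          + (y - 1) * b ?g * (?c (?V \<union> set zs) (insert ?g R \<union> S) * ?w S))"
    unfolding sum_Pow_insert[OF finite_path_edges g] VV
  proof (intro sum.cong refl)
    fix S assume "S \<in> Pow ?P"
    then have S: "S \<subseteq> ?P" by simp
    show "?c (?V \<union> set zs) (R \<union> S) * (\<Prod>e\<in>S. (y - 1) * b e) * (\<Prod>e\<in>insert ?g ?P - S. a e)
        + ?c (?V \<union> set zs) (R \<union> insert ?g S) * (\<Prod>e\<in>insert ?g S. (y - 1) * b e)
            * (\<Prod>e\<in>insert ?g ?P - insert ?g S. a e)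
      = a ?g * (?c (?V \<union> set zs) (R \<union> S) * ?w S)
        + (y - 1) * b ?g * (?c (?V \<union> set zs) (insert ?g R \<union> S) * ?w S)"
      unfolding prod_on[OF S] prod_off[OF S] diff[OF S] by (simp add: mult_ac)
  qed
  also have "\<dots> = a ?g * (?N * ?c ?V R + (y - 1) * ?F * ?c ?V (insert {z, v} R))
      + (y - 1) * b ?g * (?N * ?c ?V (insert ?g R) + (y - 1) * ?F * ?c ?V (insert {z, v} (insert ?g R)))"
  proof -
    have "e \<subseteq> ?V" if "e \<in> insert ?g R" for e
      using that Cons.prems by auto
    then have "(\<Sum>S\<in>Pow ?P. ?c (?V \<union> set zs) (R \<union> S) * ?w S)
        = ?N * ?c ?V R + (y - 1) * ?F * ?c ?V (insert {z, v} R)"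
      and "(\<Sum>S\<in>Pow ?P. ?c (?V \<union> set zs) (insert ?g R \<union> S) * ?w S)
        = ?N * ?c ?V (insert ?g R) + (y - 1) * ?F * ?c ?V (insert {z, v} (insert ?g R))"
      by (intro IH; blast)+
    then show ?thesis
      by (simp only: sum.distrib sum_distrib_left[symmetric])
  qed
  also have "?c ?V R = (x - 1) * ?c V R"
    using comps_isolated[of V z R] Cons.prems z xy by (simp add: config_weight_def)
  also have "?c ?V (insert {z, v} R) = ?c V R / (y - 1)"
    using comps_pendant[of z V v R] Cons.prems z by (simp add: config_weight_def insert_commute)
  also have "?c ?V (insert ?g R) = ?c V R / (y - 1)"
    using comps_pendant[of z V u R] Cons.prems z by (simp add: config_weight_def)
  also have "?c ?V (insert {z, v} (insert ?g R)) = ?c V (insert {u, v} R) / (y - 1)"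
    using comps_series[of z V u v R] Cons.prems z by (simp add: config_weight_def insert_commute)
  also have "a ?g * (?N * ((x - 1) * ?c V R) + (y - 1) * ?F * (?c V R / (y - 1)))
      + (y - 1) * b ?g * (?N * (?c V R / (y - 1)) + (y - 1) * ?F * (?c V (insert {u, v} R) / (y - 1)))
      = (a ?g * ((x - 1) * ?N + ?F) + b ?g * ?N) * ?c V R
        + (y - 1) * (b ?g * ?F) * ?c V (insert {u, v} R)"
  proof -
    have "A * (N * (p * c) + r * F * (c / r)) + r * B * (N * (c / r) + r * F * (d / r))
        = (A * (p * N + F) + B * N) * c + r * (B * F) * d" if "r \<noteq> 0" for A B N F p r c d :: 'a
      using that by (simp add: field_simps)
    then show ?thesis using xy by simp
  qed
  also have "a ?g * ((x - 1) * ?N + ?F) + b ?g * ?N = ear_off x (insert ?g ?P) a b"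
  proof -
    have "A * (p * ((G - F) / p) + F) + B * ((G - F) / p) = ((p * A + B) * G - B * F) / p"
      if "p \<noteq> 0" for A B F G p :: 'a
      using that by (simp add: field_simps)
    then show ?thesis using xy g by (simp add: ear_off_def ear_on_def)
  qed
  also have "b ?g * ?F = ear_on (insert ?g ?P) b"
    using g by (simp add: ear_on_def)
  finally show ?case by simp
qed

text \<open>
  The path P is parallel to the edge e. The two now connect their ends unless e is not chosen and P
  is incomplete, and if both connect them there is one edge more than needed, which is worth the
  factor y - 1.
\<close>

lemma weighted_tutte_attach_ear:
  fixes x y :: "'a::field"
  assumes xy: "x \<noteq> 1" "y \<noteq> 1"
    and "finite V" "finite E" and E: "\<And>e. e \<in> E \<Longrightarrow> e \<subseteq> V"
    and "e \<in> E" "e = {u, v}" "u \<noteq> v" "distinct zs" "set zs \<inter> V = {}"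
    and P: "P = path_edges (u # zs @ [v])" "E \<inter> P = {}"
  shows "weighted_tutte x y (V \<union> set zs) (E \<union> P) a b =
    weighted_tutte x y V E (a(e := a e * ear_off x P a b))
      (b(e := a e * ear_on P b + b e * (ear_off x P a b + (y - 1) * ear_on P b)))"
proof -
  let ?N = "ear_off x P a b" and ?F = "ear_on P b" and ?c = "config_weight x y"
  let ?a = "a(e := a e * ?N)" and ?b = "b(e := a e * ?F + b e * (?N + (y - 1) * ?F))"
  let ?w = "\<lambda>E S. (\<Prod>e\<in>S. (y - 1) * b e) * (\<Prod>e\<in>E - S. a e)"
  \<comment> \<open>The sum is split according to whether e is chosen; each case contributes a multiple of the
    configuration weight of S and one of that of insert e S.\<close>
  define E0 where "E0 = E - {e}"
  have E0: "E = insert e E0" "e \<notin> E0" "finite E0" using assms unfolding E0_def by auto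
  have uv: "u \<in> V" "v \<in> V" using E[OF \<open>e \<in> E\<close>] assms by auto
  have finP: "finite P" using P by simp
  have split: "?w (E \<union> P) (S \<union> T) = ?w E S * ?w P T" if "S \<subseteq> E" "T \<subseteq> P" for S T
  proof -
    have "(\<Prod>e\<in>S \<union> T. (y - 1) * b e) = (\<Prod>e\<in>S. (y - 1) * b e) * (\<Prod>e\<in>T. (y - 1) * b e)"
      using that P(2) assms(4) finP by (intro prod.union_disjoint) (auto intro: finite_subset)
    moreover have "E \<union> P - (S \<union> T) = (E - S) \<union> (P - T)" using that P(2) by auto
    moreover have "(\<Prod>e\<in>(E - S) \<union> (P - T). a e) = (\<Prod>e\<in>E - S. a e) * (\<Prod>e\<in>P - T. a e)"
      using P(2) assms(4) finP by (intro prod.union_disjoint) auto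
    ultimately show ?thesis by simp
  qed
  have ear: "(\<Sum>T\<in>Pow P. ?c (V \<union> set zs) (S \<union> T) * ?w P T)
      = ?N * ?c V S + (y - 1) * ?F * ?c V (insert e S)" if "S \<subseteq> E" for S
    using sum_over_ear[OF xy assms(3) uv assms(8-10), of S b a] that E P(1) assms(7)
    by (auto simp: mult.assoc)
  have "weighted_tutte x y (V \<union> set zs) (E \<union> P) a b
      = (\<Sum>S\<in>Pow E. \<Sum>T\<in>Pow P. ?c (V \<union> set zs) (S \<union> T) * ?w (E \<union> P) (S \<union> T))"
    unfolding weighted_tutte_def by (simp add: sum_Pow_Un[OF P(2)] mult.assoc)
  also have "\<dots> = (\<Sum>S\<in>Pow E. ?w E S * (\<Sum>T\<in>Pow P. ?c (V \<union> set zs) (S \<union> T) * ?w P T))"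
    unfolding sum_distrib_left
  proof (intro sum.cong refl)
    fix S T assume "S \<in> Pow E" "T \<in> Pow P"
    then have "?w (E \<union> P) (S \<union> T) = ?w E S * ?w P T" by (intro split) auto
    then show "?c (V \<union> set zs) (S \<union> T) * ?w (E \<union> P) (S \<union> T)
        = ?w E S * (?c (V \<union> set zs) (S \<union> T) * ?w P T)"
      by (simp only: mult_ac)
  qed
  also have "\<dots> = (\<Sum>S\<in>Pow E. ?w E S * (?N * ?c V S + (y - 1) * ?F * ?c V (insert e S)))"
    by (intro sum.cong refl) (simp add: ear)
  also have "\<dots> = (\<Sum>S\<in>Pow E. ?c V S * (\<Prod>e\<in>S. (y - 1) * ?b e) * (\<Prod>e\<in>E - S. ?a e))"
    unfolding E0(1) sum_Pow_insert[OF E0(3,2)]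
  proof (intro sum.cong refl)
    fix S assume "S \<in> Pow E0"
    then have S: "S \<subseteq> E0" "finite S" "e \<notin> S" using E0 by (auto intro: finite_subset)
    have "insert e E0 - S = insert e (E0 - S)" "insert e E0 - insert e S = E0 - S"
      "e \<notin> E0 - S" "finite (E0 - S)"
      using S E0 by auto
    moreover have "(\<Prod>e\<in>S. (y - 1) * ?b e) = (\<Prod>e\<in>S. (y - 1) * b e)"
      "(\<Prod>e\<in>E0 - S. ?a e) = (\<Prod>e\<in>E0 - S. a e)"
      using S E0 by (auto intro!: prod.cong)
    ultimately show "?w (insert e E0) S * (?N * ?c V S + (y - 1) * ?F * ?c V (insert e S)) +
          ?w (insert e E0) (insert e S)
            * (?N * ?c V (insert e S) + (y - 1) * ?F * ?c V (insert e (insert e S)))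
        = ?c V S * (\<Prod>e\<in>S. (y - 1) * ?b e) * (\<Prod>e\<in>insert e E0 - S. ?a e) +
          ?c V (insert e S) * (\<Prod>e\<in>insert e S. (y - 1) * ?b e)
            * (\<Prod>e\<in>insert e E0 - insert e S. ?a e)"
      using S by (simp add: prod.insert algebra_simps)
  qed
  finally show ?thesis unfolding weighted_tutte_def .
qed

lemma weighted_tutte_single_edge:
  assumes "x \<noteq> 1" "y \<noteq> 1" "u \<noteq> v"
  shows "weighted_tutte x y {u, v} {{u, v}} a b = (x - 1) * ((x - 1) * a {u, v} + b {u, v})"
proof -
  have "comps {v} {} = 1"
    using comps_le_card[of "{v}" "{}"] comps_pos[of "{v}" "{}"] by simp
  then have "comps {u, v} {} = 2" "comps {u, v} {{u, v}} = 1"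
    using comps_isolated[of "{v}" u "{}"] comps_pendant[of u "{v}" v "{}"] assms(3)
    by (simp_all add: insert_commute)
  moreover have "Pow {{u, v}} = {{}, {{u, v}}}" by auto
  ultimately show ?thesis
    using assms
    by (simp add: weighted_tutte_def config_weight_def power2_eq_square) (simp add: distrib_left mult_ac)
qed

text \<open>
  For a connected graph the two exponents in the Tutte polynomial are k - 1 and |S| - |V| + k, where
  k is the number of components of S.
\<close>

lemma tutte_eq_weighted_tutte:
  fixes x y :: "'a::field"
  assumes xy: "x \<noteq> 1" "y \<noteq> 1"
    and G: "ends G = (\<lambda>e. e)" "finite (verts G)" "finite (edges G)" "connected_graph G"
    and E: "\<And>e. e \<in> edges G \<Longrightarrow> \<exists>u\<in>verts G. \<exists>v\<in>verts G. e = {u, v}"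
  shows "tutte G x y = weighted_tutte x y (verts G) (edges G) (\<lambda>_. 1) (\<lambda>_. 1) / (x - 1)"
proof -
  let ?V = "verts G" and ?k = "comps (verts G)"
  have con: "?k (edges G) = 1"
    using G(4) unfolding connected_graph_def num_components_eq_comps[OF G(1)] .
  then have ne: "?V \<noteq> {}" by (auto simp: comps_def)
  have "(x - 1) ^ (rank G (edges G) - rank G S) * (y - 1) ^ (card S - rank G S)
      = config_weight x y ?V S * (\<Prod>e\<in>S. (y - 1) * 1) * (\<Prod>e\<in>edges G - S. 1) / (x - 1)"
    if "S \<subseteq> edges G" for S
  proof -
    have "card ?V \<le> card S + ?k S"
      by (rule card_le_comps[OF G(2) finite_subset[OF that G(3)]]) (use E that in auto)
    then have k: "0 < ?k S" "?k S \<le> card ?V" "card ?V \<le> card S + ?k S"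
      using comps_pos[OF G(2) ne] comps_le_card[OF G(2)] by auto
    have "rank G (edges G) - rank G S = ?k S - 1"
      using k con unfolding rank_def num_components_eq_comps[OF G(1)] by simp
    moreover have "card S - rank G S = card S + ?k S - card ?V"
      using k unfolding rank_def num_components_eq_comps[OF G(1)] by simp
    ultimately show ?thesis
      using k xy by (simp add: config_weight_def power_mult_distrib power_diff power_add mult_ac)
  qed
  then show ?thesis
    unfolding tutte_def weighted_tutte_def sum_divide_distrib by (intro sum.cong) auto
qed

section \<open>Hexagons of the hexagonal lattice\<close>

lemma corners_Pair:
  "corners (i, j) = {(i + 1, j), (i + 1, j + 1), (i, j + 1), (i - 1, j), (i - 1, j - 1), (i, j - 1)}"
  unfolding corners_def unit_vectors_def by auto

lemma sides_Pair:
  "sides (i, j) = {{(i + 1, j), (i + 1, j + 1)}, {(i + 1, j + 1), (i, j + 1)},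
     {(i, j + 1), (i - 1, j)}, {(i - 1, j), (i - 1, j - 1)},
     {(i - 1, j - 1), (i, j - 1)}, {(i, j - 1), (i + 1, j)}}"
  (is "_ = ?S")
proof
  show "sides (i, j) \<subseteq> ?S"
  proof
    fix e assume "e \<in> sides (i, j)"
    then obtain q d where e: "e = {q, q + d}" and q: "q \<in> corners (i, j)" and d: "d \<in> unit_vectors"
      and r: "q + d \<in> corners (i, j)"
      unfolding sides_def by (auto simp: algebra_simps) (metis add_diff_cancel_left' diff_add_cancel)
    have "(q, d) \<in> {((i + 1, j), (0, 1)), ((i + 1, j), (-1, -1)), ((i + 1, j + 1), (-1, 0)),
      ((i + 1, j + 1), (0, -1)), ((i, j + 1), (-1, -1)), ((i, j + 1), (1, 0)),
      ((i - 1, j), (0, -1)), ((i - 1, j), (1, 1)), ((i - 1, j - 1), (1, 0)),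
      ((i - 1, j - 1), (0, 1)), ((i, j - 1), (1, 1)), ((i, j - 1), (-1, 0))}"
      using q d r unfolding corners_Pair unit_vectors_def by (elim insertE emptyE) simp_all
    then show "e \<in> ?S"
      unfolding e by (elim insertE emptyE) (simp_all add: insert_commute)
  qed
  show "?S \<subseteq> sides (i, j)"
  proof -
    have "{q, r} \<in> sides (i, j)"
      if "q \<in> corners (i, j)" "r \<in> corners (i, j)" "r - q \<in> unit_vectors" for q r
      using that unfolding sides_def by blast
    then show ?thesis
      by (simp add: corners_Pair unit_vectors_def)
  qed
qed

text \<open>
  The sides other than e form a path around the hexagon from one end of e to the other. This is the
  path that is attached when a hexagon is glued on along e.
\<close>

lemma sides_path:
  assumes "e \<in> sides p"
  obtains u v zs where "e = {u, v}" "u \<noteq> v" "distinct zs" "set zs \<inter> {u, v} = {}"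
    "corners p = {u, v} \<union> set zs" "sides p = insert e (path_edges (u # zs @ [v]))"
    "e \<notin> path_edges (u # zs @ [v])"
proof -
  obtain i j where p: "p = (i, j)" by (cases p)
  let ?a = "(i + 1, j)" and ?b = "(i + 1, j + 1)" and ?c = "(i, j + 1)"
    and ?d = "(i - 1, j)" and ?e = "(i - 1, j - 1)" and ?f = "(i, j - 1)"
  have "e = {?a, ?b} \<or> e = {?b, ?c} \<or> e = {?c, ?d} \<or> e = {?d, ?e} \<or> e = {?e, ?f} \<or> e = {?f, ?a}"
    using assms unfolding p sides_Pair by simp
  then show thesis
  proof (elim disjE)
    assume "e = {?a, ?b}"
    then show thesis
      by (intro that[of ?b ?a "[?c, ?d, ?e, ?f]"])
        (simp_all add: p corners_Pair sides_Pair insert_commute doubleton_eq_iff)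
  next
    assume "e = {?b, ?c}"
    then show thesis
      by (intro that[of ?c ?b "[?d, ?e, ?f, ?a]"])
        (simp_all add: p corners_Pair sides_Pair insert_commute doubleton_eq_iff)
  next
    assume "e = {?c, ?d}"
    then show thesis
      by (intro that[of ?d ?c "[?e, ?f, ?a, ?b]"])
        (simp_all add: p corners_Pair sides_Pair insert_commute doubleton_eq_iff)
  next
    assume "e = {?d, ?e}"
    then show thesis
      by (intro that[of ?e ?d "[?f, ?a, ?b, ?c]"])
        (simp_all add: p corners_Pair sides_Pair insert_commute doubleton_eq_iff)
  next
    assume "e = {?e, ?f}"
    then show thesis
      by (intro that[of ?f ?e "[?a, ?b, ?c, ?d]"])
        (simp_all add: p corners_Pair sides_Pair insert_commute doubleton_eq_iff)
  next
    assume "e = {?f, ?a}"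
    then show thesis
      by (intro that[of ?a ?f "[?b, ?c, ?d, ?e]"])
        (simp_all add: p corners_Pair sides_Pair insert_commute doubleton_eq_iff)
  qed
qed

lemma finite_corners [simp]: "finite (corners p)"
  by (cases p) (simp add: corners_Pair)

lemma finite_sides [simp]: "finite (sides p)"
  by (cases p) (simp add: sides_Pair)

lemma card_sides: "card (sides p) = 6"
  by (cases p) (simp add: sides_Pair doubleton_eq_iff)

lemma side_endpoints: "e \<in> sides p \<Longrightarrow> \<exists>u\<in>corners p. \<exists>v\<in>corners p. e = {u, v}"
  by (auto simp: sides_def)

lemma side_subset_corners: "e \<in> sides p \<Longrightarrow> e \<subseteq> corners p"
  by (auto simp: sides_def)

lemma card_side: "e \<in> sides p \<Longrightarrow> card e = 2"
  by (rule sides_path[of e p]) auto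

text \<open>
  The difference of two centres with a common corner is a difference of two unit vectors.
  Divisibility of its coordinate sum by 3 leaves six possibilities, one for each side.
\<close>

lemma common_corners_side:
  assumes "p \<in> hexagons" "q \<in> hexagons" "p \<noteq> q" "corners p \<inter> corners q \<noteq> {}"
  shows "corners p \<inter> corners q \<in> sides p"
proof -
  obtain i j k l where p: "p = (i, j)" and q: "q = (i + k, j + l)"
    by (metis surj_pair add_diff_cancel_left' diff_add_cancel add.commute)
  have 3: "3 dvd k + l"
    using assms(1,2) unfolding hexagons_def p q
    by simp (metis add.commute add.left_commute dvd_add_right_iff)
  have "(k, l) \<noteq> (0, 0)" using assms(3) p q by auto
  moreover obtain r where "r \<in> corners p" "r \<in> corners q" using assms(4) by auto
  ultimately have "(k, l) \<in> {(1, -1), (2, 1), (1, 2), (-1, 1), (-2, -1), (-1, -2)}"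
    using 3 unfolding p q corners_Pair by (cases r) (elim insertE emptyE; simp; presburger?)
  then show ?thesis
    unfolding p q
  proof (elim insertE emptyE)
    assume "(k, l) = (1, -1)"
    then have "corners (i, j) \<inter> corners (i + k, j + l) = {(i, j - 1), (i + 1, j)}"
      by (auto simp: corners_Pair)
    then show "corners (i, j) \<inter> corners (i + k, j + l) \<in> sides (i, j)" by (simp add: sides_Pair)
  next
    assume "(k, l) = (2, 1)"
    then have "corners (i, j) \<inter> corners (i + k, j + l) = {(i + 1, j), (i + 1, j + 1)}"
      by (auto simp: corners_Pair)
    then show "corners (i, j) \<inter> corners (i + k, j + l) \<in> sides (i, j)" by (simp add: sides_Pair)
  next
    assume "(k, l) = (1, 2)"
    then have "corners (i, j) \<inter> corners (i + k, j + l) = {(i + 1, j + 1), (i, j + 1)}"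
      by (auto simp: corners_Pair)
    then show "corners (i, j) \<inter> corners (i + k, j + l) \<in> sides (i, j)" by (simp add: sides_Pair)
  next
    assume "(k, l) = (-1, 1)"
    then have "corners (i, j) \<inter> corners (i + k, j + l) = {(i, j + 1), (i - 1, j)}"
      by (auto simp: corners_Pair)
    then show "corners (i, j) \<inter> corners (i + k, j + l) \<in> sides (i, j)" by (simp add: sides_Pair)
  next
    assume "(k, l) = (-2, -1)"
    then have "corners (i, j) \<inter> corners (i + k, j + l) = {(i - 1, j), (i - 1, j - 1)}"
      by (auto simp: corners_Pair)
    then show "corners (i, j) \<inter> corners (i + k, j + l) \<in> sides (i, j)" by (simp add: sides_Pair)
  next
    assume "(k, l) = (-1, -2)"
    then have "corners (i, j) \<inter> corners (i + k, j + l) = {(i - 1, j - 1), (i, j - 1)}"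
      by (auto simp: corners_Pair)
    then show "corners (i, j) \<inter> corners (i + k, j + l) \<in> sides (i, j)" by (simp add: sides_Pair)
  qed
qed

lemma common_side_unique:
  assumes "p \<in> hexagons" "q \<in> hexagons" "p \<noteq> q" "e \<in> sides p" "e \<in> sides q"
  shows "e = corners p \<inter> corners q"
proof (rule card_subset_eq)
  show sub: "e \<subseteq> corners p \<inter> corners q"
    using assms(4,5) side_subset_corners by blast
  then have "corners p \<inter> corners q \<noteq> {}"
    using card_side[OF assms(4)] by (metis card.empty subset_empty zero_neq_numeral)
  then show "card e = card (corners p \<inter> corners q)"
    using common_corners_side[OF assms(1-3)] card_side assms(4) by metis
qed simp

lemma adjacent_iff_common_corner:
  assumes "p \<in> hexagons" "q \<in> hexagons"
  shows "adjacent p q \<longleftrightarrow> p \<noteq> q \<and> corners p \<inter> corners q \<noteq> {}"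
proof
  assume "adjacent p q"
  then show "p \<noteq> q \<and> corners p \<inter> corners q \<noteq> {}"
    using common_side_unique[OF assms] card_side unfolding adjacent_def
    by (metis Int_emptyI card.empty disjoint_iff zero_neq_numeral)
next
  assume "p \<noteq> q \<and> corners p \<inter> corners q \<noteq> {}"
  then show "adjacent p q"
    using common_corners_side[of p q] common_corners_side[of q p] assms
    unfolding adjacent_def by (auto simp: Int_commute)
qed

lemma adjacent_common_side:
  assumes "p \<in> hexagons" "q \<in> hexagons" "adjacent p q"
  shows "corners p \<inter> corners q \<in> sides p" "corners p \<inter> corners q \<in> sides q"
  using assms adjacent_iff_common_corner[OF assms(1,2)] common_corners_side[of p q]
    common_corners_side[of q p] by (auto simp: Int_commute)

section \<open>Removal of a hexagon with a single neighbour\<close>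

definition hex_tutte ::
    "'a::field \<Rightarrow> 'a \<Rightarrow> point set \<Rightarrow> (point set \<Rightarrow> 'a) \<Rightarrow> (point set \<Rightarrow> 'a) \<Rightarrow> 'a" where
  "hex_tutte x y H a b = weighted_tutte x y (\<Union>p\<in>H. corners p) (\<Union>p\<in>H. sides p) a b"

text \<open>
  The condition is on adjacency only. That p has no corner in common with members of H other than q
  is a property of the lattice.
\<close>

definition leaf :: "point \<Rightarrow> point \<Rightarrow> point set \<Rightarrow> bool" where
  "leaf p q H \<longleftrightarrow> finite H \<and> insert p H \<subseteq> hexagons \<and> p \<notin> H \<and> q \<in> H \<and>
     (\<forall>r\<in>H. adjacent p r \<longleftrightarrow> r = q)"

lemma leaf_common_side:
  assumes "leaf p q H"
  shows "corners p \<inter> corners q \<in> sides p" "corners p \<inter> corners q \<in> sides q"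
  using assms adjacent_common_side[of p q] by (auto simp: leaf_def)

text \<open>
  This lets a weight on a side of p other than the common one be reset once p is removed.
\<close>

lemma leaf_side_private:
  assumes "leaf p q H" "g \<in> sides p" "g \<noteq> corners p \<inter> corners q" "r \<in> H"
  shows "g \<notin> sides r"
proof
  assume "g \<in> sides r"
  then have "adjacent p r" "g = corners p \<inter> corners r"
    using assms common_side_unique[of p r g] by (auto simp: leaf_def adjacent_def)
  then show False using assms by (auto simp: leaf_def)
qed

lemma hex_tutte_leaf:
  fixes x y :: "'a::field"
  assumes xy: "x \<noteq> 1" "y \<noteq> 1" and leaf: "leaf p q H"
    and e: "e = corners p \<inter> corners q" and P: "P = sides p - {e}"
  shows "hex_tutte x y (insert p H) a b =
    hex_tutte x y H (a(e := a e * ear_off x P a b))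
      (b(e := a e * ear_on P b + b e * (ear_off x P a b + (y - 1) * ear_on P b)))"
proof -
  let ?V = "\<Union>r\<in>H. corners r" and ?E = "\<Union>r\<in>H. sides r"
  have H: "finite H" "p \<in> hexagons" "q \<in> H" using leaf by (auto simp: leaf_def)
  have eq: "e \<in> sides p" "e \<in> sides q" using leaf_common_side[OF leaf] e by auto
  then obtain u v zs where zs: "e = {u, v}" "u \<noteq> v" "distinct zs" "set zs \<inter> {u, v} = {}"
    "corners p = {u, v} \<union> set zs" "sides p = insert e (path_edges (u # zs @ [v]))"
    "e \<notin> path_edges (u # zs @ [v])"
    by (rule_tac sides_path)
  have new: "set zs \<inter> ?V = {}"
  proof -
    have "z \<notin> corners r" if "z \<in> set zs" "r \<in> H" for z r
    proof
      assume z: "z \<in> corners r"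
      have "z \<in> corners p" using that zs by auto
      moreover have "r \<in> hexagons" "p \<noteq> r" using leaf that by (auto simp: leaf_def)
      ultimately have "adjacent p r"
        using z H by (auto simp: adjacent_iff_common_corner)
      then have "r = q" using leaf that by (auto simp: leaf_def)
      then have "z \<in> e" using z \<open>z \<in> corners p\<close> e by auto
      then show False using zs that by auto
    qed
    then show ?thesis by auto
  qed
  have eV: "e \<subseteq> ?V" using side_subset_corners[OF eq(2)] H by auto
  have V: "(\<Union>r\<in>insert p H. corners r) = ?V \<union> set zs"
    using zs(1,5) eV by auto
  have PP: "P = path_edges (u # zs @ [v])" using P zs by auto
  have "?E \<inter> P = {}" using leaf_side_private[OF leaf] e unfolding P by auto
  moreover have "(\<Union>r\<in>insert p H. sides r) = ?E \<union> P"
    using P eq H by auto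
  moreover have "f \<subseteq> ?V" if "f \<in> ?E" for f
    using that side_subset_corners by blast
  ultimately show ?thesis
    unfolding hex_tutte_def V
    using weighted_tutte_attach_ear[OF xy, of ?V ?E e u v zs P a b] zs new PP eq H by auto
qed

text \<open>
  The maps \<open>end_ear\<close> and \<open>centre_ear\<close> give the new weights of a plain
  edge, when a hexagon is glued onto it which has a given pair of weights on one, respectively on
  each of two, of its other five sides. A plain hexagon is covered by the pair (1, 1).
\<close>

definition end_ear :: "'a::field \<Rightarrow> 'a \<Rightarrow> 'a \<times> 'a \<Rightarrow> 'a \<times> 'a" where
  "end_ear x y = (\<lambda>(a, b). (x^4 * a + (1 + x + x^2 + x^3) * b, x^4 * a + (1 + x + x^2 + x^3 + y) * b))"

definition centre_ear :: "'a::field \<Rightarrow> 'a \<Rightarrow> 'a \<times> 'a \<Rightarrow> 'a \<times> 'a \<Rightarrow> 'a \<times> 'a" where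
  "centre_ear x y = (\<lambda>(a1, b1) (a2, b2).
     let N = x^3 * ((x - 1) * a1 * a2 + a1 * b2 + b1 * a2) + (1 + x + x^2) * (b1 * b2)
     in (N, N + y * (b1 * b2)))"

text \<open>
  The hexagons w and b are absorbed by c, then c by u, and u by the preceding unit.
\<close>

definition unit_ear :: "'a::field \<Rightarrow> 'a \<Rightarrow> 'a \<times> 'a \<Rightarrow> 'a \<times> 'a" where
  "unit_ear x y s = end_ear x y (centre_ear x y (end_ear x y s) (end_ear x y (1, 1)))"

text \<open>
  Each plain edge contributes (x - 1) + 1 = x to the product defining \<open>ear_off\<close>, and
  division by x - 1 turns \<open>x ^ 4 - 1\<close> into the geometric sum.
\<close>

lemma ear_one_special:
  assumes "x \<noteq> 1" "card P = 5" "g \<in> P" and "\<And>f. f \<in> P \<Longrightarrow> a f = 1 \<and> b f = 1"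
  shows "ear_on P (b(g := \<beta>)) = \<beta>"
    and "ear_off x P (a(g := \<alpha>)) (b(g := \<beta>)) = x^4 * \<alpha> + (1 + x + x^2 + x^3) * \<beta>"
proof -
  have fin: "finite P" and card: "card (P - {g}) = 4"
    using assms(2,3) by (auto intro: card_ge_0_finite)
  have P: "(\<Prod>f\<in>P. F f) = F g * (\<Prod>f\<in>P - {g}. F f)" for F :: "_ \<Rightarrow> 'a"
    using fin assms(3) by (rule prod.remove)
  have "(\<Prod>f\<in>P - {g}. (b(g := \<beta>)) f) = 1"
    using assms(4) by (intro prod.neutral) auto
  then show on: "ear_on P (b(g := \<beta>)) = \<beta>"
    by (simp add: ear_on_def P)
  have "(\<Prod>f\<in>P - {g}. (x - 1) * (a(g := \<alpha>)) f + (b(g := \<beta>)) f) = (\<Prod>f\<in>P - {g}. x)"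
    using assms(4) by (intro prod.cong) auto
  also have "\<dots> = x ^ 4" by (simp add: card)
  finally have "ear_off x P (a(g := \<alpha>)) (b(g := \<beta>)) = (((x - 1) * \<alpha> + \<beta>) * x ^ 4 - \<beta>) / (x - 1)"
    using on by (simp add: ear_off_def ear_on_def P)
  also have "\<dots> = x^4 * \<alpha> + (1 + x + x^2 + x^3) * \<beta>"
    using assms(1) by (simp add: divide_eq_eq) (simp add: algebra_simps eval_nat_numeral)
  finally show "ear_off x P (a(g := \<alpha>)) (b(g := \<beta>)) = x^4 * \<alpha> + (1 + x + x^2 + x^3) * \<beta>" .
qed

lemma ear_two_special:
  assumes "x \<noteq> 1" "card P = 5" "g \<in> P" "h \<in> P" "g \<noteq> h" and "\<And>f. f \<in> P \<Longrightarrow> a f = 1 \<and> b f = 1"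
  shows "ear_on P (b(g := \<beta>, h := \<delta>)) = \<beta> * \<delta>"
    and "ear_off x P (a(g := \<alpha>, h := \<gamma>)) (b(g := \<beta>, h := \<delta>)) =
      x^3 * ((x - 1) * \<alpha> * \<gamma> + \<alpha> * \<delta> + \<beta> * \<gamma>) + (1 + x + x^2) * (\<beta> * \<delta>)"
proof -
  have fin: "finite P" and card: "card (P - {g} - {h}) = 3"
    using assms(2-5) by (auto intro: card_ge_0_finite)
  have P: "(\<Prod>f\<in>P. F f) = F g * (F h * (\<Prod>f\<in>P - {g} - {h}. F f))" for F :: "_ \<Rightarrow> 'a"
    using fin assms(3-5) by (simp add: prod.remove[of P g] prod.remove[of "P - {g}" h])
  have "(\<Prod>f\<in>P - {g} - {h}. (b(g := \<beta>, h := \<delta>)) f) = 1"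
    using assms(6) by (intro prod.neutral) auto
  then show on: "ear_on P (b(g := \<beta>, h := \<delta>)) = \<beta> * \<delta>"
    using assms(5) by (simp add: ear_on_def P)
  have "(\<Prod>f\<in>P - {g} - {h}. (x - 1) * (a(g := \<alpha>, h := \<gamma>)) f + (b(g := \<beta>, h := \<delta>)) f)
      = (\<Prod>f\<in>P - {g} - {h}. x)"
    using assms(6) by (intro prod.cong) auto
  also have "\<dots> = x ^ 3" by (simp add: card)
  finally have "ear_off x P (a(g := \<alpha>, h := \<gamma>)) (b(g := \<beta>, h := \<delta>))
      = (((x - 1) * \<alpha> + \<beta>) * (((x - 1) * \<gamma> + \<delta>) * x ^ 3) - \<beta> * \<delta>) / (x - 1)"
    using on assms(5) by (simp add: ear_off_def ear_on_def P)
  also have "\<dots> = x^3 * ((x - 1) * \<alpha> * \<gamma> + \<alpha> * \<delta> + \<beta> * \<gamma>) + (1 + x + x^2) * (\<beta> * \<delta>)"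
    using assms(1) by (simp add: divide_eq_eq) (simp add: algebra_simps eval_nat_numeral)
  finally show "ear_off x P (a(g := \<alpha>, h := \<gamma>)) (b(g := \<beta>, h := \<delta>)) =
      x^3 * ((x - 1) * \<alpha> * \<gamma> + \<alpha> * \<delta> + \<beta> * \<gamma>) + (1 + x + x^2) * (\<beta> * \<delta>)" .
qed

lemma card_sides_minus: "e \<in> sides p \<Longrightarrow> card (sides p - {e}) = 5"
  by (simp add: card_sides)

lemma other_side:
  obtains g where "g \<in> sides p" "g \<noteq> e"
proof -
  have "\<not> sides p \<subseteq> {e}"
    using card_sides[of p] card_mono[of "{e}" "sides p"] by auto
  then show thesis using that by blast
qed

lemma hex_tutte_cong:
  assumes "\<And>f r. r \<in> H \<Longrightarrow> f \<in> sides r \<Longrightarrow> a f = a' f \<and> b f = b' f"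
  shows "hex_tutte x y H a b = hex_tutte x y H a' b'"
  unfolding hex_tutte_def by (rule weighted_tutte_cong) (use assms in auto)

text \<open>
  The weights are arbitrary away from the sides of p, because other hexagons removed earlier may
  have left their weights there.
\<close>

lemma remove_end_hexagon:
  fixes x y :: "'a::field"
  assumes xy: "x \<noteq> 1" "y \<noteq> 1" and leaf: "leaf p q H"
    and e: "e = corners p \<inter> corners q"
    and g: "g \<in> sides p" "g \<noteq> e"
    and std: "\<And>f. f \<in> sides p \<Longrightarrow> a f = 1 \<and> b f = 1"
    and out: "end_ear x y (\<alpha>, \<beta>) = (\<alpha>', \<beta>')"
  shows "hex_tutte x y (insert p H) (a(g := \<alpha>)) (b(g := \<beta>)) = hex_tutte x y H (a(e := \<alpha>')) (b(e := \<beta>'))"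
proof -
  let ?P = "sides p - {e}"
  have ep: "e \<in> sides p" using leaf_common_side[OF leaf] e by simp
  have on: "ear_on ?P (b(g := \<beta>)) = \<beta>"
    and off: "ear_off x ?P (a(g := \<alpha>)) (b(g := \<beta>)) = x^4 * \<alpha> + (1 + x + x^2 + x^3) * \<beta>"
    using ear_one_special[OF xy(1) card_sides_minus[OF ep], of g a b] g std by auto
  have ae: "(a(g := \<alpha>)) e = 1" "(b(g := \<beta>)) e = 1" using g std[OF ep] by auto
  have \<alpha>': "\<alpha>' = x^4 * \<alpha> + (1 + x + x^2 + x^3) * \<beta>" and \<beta>': "\<beta>' = \<alpha>' + y * \<beta>"
    using out by (auto simp: end_ear_def algebra_simps)
  have "hex_tutte x y (insert p H) (a(g := \<alpha>)) (b(g := \<beta>))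
      = hex_tutte x y H (a(g := \<alpha>, e := \<alpha>')) (b(g := \<beta>, e := \<beta>'))"
    unfolding hex_tutte_leaf[OF xy leaf e refl] on off ae \<beta>' \<alpha>'
    by (simp add: algebra_simps)
  also have "\<dots> = hex_tutte x y H (a(e := \<alpha>')) (b(e := \<beta>'))"
    using leaf_side_private[OF leaf g(1)] g(2) e by (intro hex_tutte_cong) auto
  finally show ?thesis .
qed

lemma remove_centre_hexagon:
  fixes x y :: "'a::field"
  assumes xy: "x \<noteq> 1" "y \<noteq> 1" and leaf: "leaf p q H"
    and e: "e = corners p \<inter> corners q"
    and g: "g \<in> sides p" "g \<noteq> e" and h: "h \<in> sides p" "h \<noteq> e" "g \<noteq> h"
    and std: "\<And>f. f \<in> sides p \<Longrightarrow> a f = 1 \<and> b f = 1"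
    and out: "centre_ear x y (\<alpha>, \<beta>) (\<gamma>, \<delta>) = (\<alpha>', \<beta>')"
  shows "hex_tutte x y (insert p H) (a(g := \<alpha>, h := \<gamma>)) (b(g := \<beta>, h := \<delta>))
    = hex_tutte x y H (a(e := \<alpha>')) (b(e := \<beta>'))"
proof -
  let ?P = "sides p - {e}"
  have ep: "e \<in> sides p" using leaf_common_side[OF leaf] e by simp
  have on: "ear_on ?P (b(g := \<beta>, h := \<delta>)) = \<beta> * \<delta>"
    and off: "ear_off x ?P (a(g := \<alpha>, h := \<gamma>)) (b(g := \<beta>, h := \<delta>))
      = x^3 * ((x - 1) * \<alpha> * \<gamma> + \<alpha> * \<delta> + \<beta> * \<gamma>) + (1 + x + x^2) * (\<beta> * \<delta>)"
    using ear_two_special[OF xy(1) card_sides_minus[OF ep], of g h a b] g h std by auto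
  have ae: "(a(g := \<alpha>, h := \<gamma>)) e = 1" "(b(g := \<beta>, h := \<delta>)) e = 1" using g h std[OF ep] by auto
  have \<alpha>': "\<alpha>' = x^3 * ((x - 1) * \<alpha> * \<gamma> + \<alpha> * \<delta> + \<beta> * \<gamma>) + (1 + x + x^2) * (\<beta> * \<delta>)"
    and \<beta>': "\<beta>' = \<alpha>' + y * (\<beta> * \<delta>)"
    using out by (auto simp: centre_ear_def Let_def)
  have "hex_tutte x y (insert p H) (a(g := \<alpha>, h := \<gamma>)) (b(g := \<beta>, h := \<delta>))
      = hex_tutte x y H (a(g := \<alpha>, h := \<gamma>, e := \<alpha>')) (b(g := \<beta>, h := \<delta>, e := \<beta>'))"
    unfolding hex_tutte_leaf[OF xy leaf e refl] on off ae \<beta>' \<alpha>'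
    by (simp add: algebra_simps)
  also have "\<dots> = hex_tutte x y H (a(e := \<alpha>')) (b(e := \<beta>'))"
    using leaf_side_private[OF leaf g(1)] leaf_side_private[OF leaf h(1)] g(2) h(2) e
    by (intro hex_tutte_cong) auto
  finally show ?thesis .
qed

text \<open>
  A hexagon is a path of five edges attached to a single edge, so this is the base of the recursion.
\<close>

lemma hex_tutte_single:
  fixes x y :: "'a::field"
  assumes xy: "x \<noteq> 1" "y \<noteq> 1" and g: "g \<in> sides p"
    and out: "end_ear x y (\<alpha>, \<beta>) = (\<alpha>', \<beta>')"
  shows "hex_tutte x y {p} ((\<lambda>_. 1)(g := \<alpha>)) ((\<lambda>_. 1)(g := \<beta>)) = (x - 1) * ((x - 1) * \<alpha>' + \<beta>')"
proof -
  obtain e where e: "e \<in> sides p" "g \<noteq> e"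
    using other_side[of p g] by metis
  obtain u v zs where zs: "e = {u, v}" "u \<noteq> v" "distinct zs" "set zs \<inter> {u, v} = {}"
    "corners p = {u, v} \<union> set zs" "sides p = insert e (path_edges (u # zs @ [v]))"
    "e \<notin> path_edges (u # zs @ [v])"
    using e(1) by (rule sides_path)
  let ?P = "sides p - {e}" and ?a = "(\<lambda>_. 1)(g := \<alpha>)" and ?b = "(\<lambda>_. 1)(g := \<beta>)"
  have P: "?P = path_edges (u # zs @ [v])" using zs by auto
  have on: "ear_on ?P ?b = \<beta>"
    and off: "ear_off x ?P ?a ?b = x^4 * \<alpha> + (1 + x + x^2 + x^3) * \<beta>"
    using ear_one_special[OF xy(1) card_sides_minus[OF e(1)], of g "\<lambda>_. 1" "\<lambda>_. 1"] g e by auto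
  have "{e} \<union> ?P = sides p" using e by auto
  then have "hex_tutte x y {p} ?a ?b
      = weighted_tutte x y ({u, v} \<union> set zs) ({e} \<union> ?P) ?a ?b"
    using zs(5) by (simp add: hex_tutte_def)
  also have "\<dots> = weighted_tutte x y {u, v} {e} (?a(e := ?a e * ear_off x ?P ?a ?b))
      (?b(e := ?a e * ear_on ?P ?b + ?b e * (ear_off x ?P ?a ?b + (y - 1) * ear_on ?P ?b)))"
    using zs P by (intro weighted_tutte_attach_ear[OF xy, where u=u and v=v]) auto
  also have "\<dots> = (x - 1) * ((x - 1) * \<alpha>' + \<beta>')"
  proof -
    have K2: "weighted_tutte x y {u, v} {e} a b = (x - 1) * ((x - 1) * a e + b e)" for a b
      unfolding zs(1) by (rule weighted_tutte_single_edge[OF xy zs(2)])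
    have "?a e = 1" "?b e = 1" using e(2) by auto
    then show ?thesis
      unfolding K2 fun_upd_same on off using out by (auto simp: end_ear_def algebra_simps)
  qed
  finally show ?thesis .
qed

section \<open>Unit by unit removal from a triphenylene chain\<close>

lemma fused_iff:
  "fused s t \<longleftrightarrow> (fst s = Hex_c \<and> fst t \<noteq> Hex_c \<and> snd t = snd s) \<or>
     (fst s = Hex_w \<and> fst t = Hex_u \<and> snd t = Suc (snd s))"
proof -
  obtain k i l j where "s = (k, i)" "t = (l, j)" by (metis surj_pair)
  then show ?thesis
    by (cases k; cases l) (auto simp: fused.simps)
qed

definition chain_labelling :: "(hex_kind \<times> nat \<Rightarrow> point) \<Rightarrow> nat \<Rightarrow> bool" where
  "chain_labelling h n \<longleftrightarrow> inj_on h (UNIV \<times> {1..n}) \<and> h ` (UNIV \<times> {1..n}) \<subseteq> hexagons \<and>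
     (\<forall>s\<in>UNIV \<times> {1..n}. \<forall>t\<in>UNIV \<times> {1..n}. adjacent (h s) (h t) \<longleftrightarrow> fused s t \<or> fused t s)"

lemma chain_labelling_mono: "chain_labelling h n \<Longrightarrow> m \<le> n \<Longrightarrow> chain_labelling h m"
  unfolding chain_labelling_def by (fastforce intro: inj_on_subset)

lemma UNIV_hex_kind: "UNIV = {Hex_c, Hex_u, Hex_w, Hex_b}"
  using hex_kind.exhaust by auto

lemma not_fused_no_common_side:
  assumes "chain_labelling h n" "e \<in> sides (h s)" "\<not> fused s t" "\<not> fused t s" "s \<noteq> t"
    "s \<in> UNIV \<times> {1..n}" "t \<in> UNIV \<times> {1..n}"
  shows "e \<notin> sides (h t)"
proof
  assume "e \<in> sides (h t)"
  moreover have "h s \<noteq> h t"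
    using assms unfolding chain_labelling_def inj_on_def by blast
  ultimately have "adjacent (h s) (h t)" using assms(2) by (auto simp: adjacent_def)
  then show False using assms unfolding chain_labelling_def by blast
qed

lemma fused_common_side:
  assumes "chain_labelling h n" "fused s t" "s \<in> UNIV \<times> {1..n}" "t \<in> UNIV \<times> {1..n}"
  shows "corners (h s) \<inter> corners (h t) \<in> sides (h s)"
proof (rule adjacent_common_side(1))
  show "h s \<in> hexagons" "h t \<in> hexagons" "adjacent (h s) (h t)"
    using assms unfolding chain_labelling_def by blast+
qed

text \<open>
  Adjacency is transported to the names, where it can be decided from the definition of
  \<open>fused\<close>.
\<close>

lemma leaf_image:
  assumes "chain_labelling h n" "S \<subseteq> UNIV \<times> {1..n}" "s \<in> UNIV \<times> {1..n}" "s \<notin> S" "t \<in> S"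
    and "\<And>r. r \<in> S \<Longrightarrow> fused s r \<or> fused r s \<longleftrightarrow> r = t"
  shows "leaf (h s) (h t) (h ` S)"
proof -
  have inj: "inj_on h (insert s S)"
    using assms(1-3) unfolding chain_labelling_def by (meson inj_on_subset insert_subset)
  have adj: "adjacent (h s) (h r) \<longleftrightarrow> r = t" if "r \<in> S" for r
    using assms that unfolding chain_labelling_def by blast
  have "finite S" using assms(2) by (rule finite_subset) (simp add: UNIV_hex_kind)
  moreover have "insert (h s) (h ` S) \<subseteq> hexagons"
    using assms(1-3) unfolding chain_labelling_def by blast
  moreover have "h s \<notin> h ` S" using inj assms(4) by (auto simp: inj_on_def)
  moreover have "h r = h t \<longleftrightarrow> r = t" if "r \<in> S" for r
    using inj that assms(5) by (auto simp: inj_on_def)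
  ultimately show ?thesis
    using adj assms(5) unfolding leaf_def by auto
qed

text \<open>
  The side shared by w and c and the one shared by b and c both carry non-plain weights when c is
  removed; they are distinct since w and b have no common side.
\<close>

lemma remove_unit:
  fixes x y :: "'a::field"
  assumes xy: "x \<noteq> 1" "y \<noteq> 1" and h: "chain_labelling h (Suc k)"
    and g: "g \<in> sides (h (Hex_w, Suc k))"
      "g \<noteq> corners (h (Hex_w, Suc k)) \<inter> corners (h (Hex_c, Suc k))"
    and out: "centre_ear x y (end_ear x y (\<alpha>, \<beta>)) (end_ear x y (1, 1)) = (\<alpha>', \<beta>')"
  shows "hex_tutte x y (h ` (UNIV \<times> {1..Suc k})) ((\<lambda>_. 1)(g := \<alpha>)) ((\<lambda>_. 1)(g := \<beta>))
    = hex_tutte x y (h ` insert (Hex_u, Suc k) (UNIV \<times> {1..k}))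
        ((\<lambda>_. 1)(corners (h (Hex_c, Suc k)) \<inter> corners (h (Hex_u, Suc k)) := \<alpha>'))
        ((\<lambda>_. 1)(corners (h (Hex_c, Suc k)) \<inter> corners (h (Hex_u, Suc k)) := \<beta>'))"
proof -
  let ?c = "(Hex_c, Suc k)" and ?u = "(Hex_u, Suc k)" and ?w = "(Hex_w, Suc k)" and ?b = "(Hex_b, Suc k)"
  let ?U = "insert ?u (UNIV \<times> {1..k})"
  let ?ew = "corners (h ?w) \<inter> corners (h ?c)" and ?eb = "corners (h ?b) \<inter> corners (h ?c)"
    and ?eu = "corners (h ?c) \<inter> corners (h ?u)"
  have split: "UNIV \<times> {1..Suc k} = insert ?w (insert ?b (insert ?c ?U))"
    by (auto simp: UNIV_hex_kind le_Suc_eq)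
  have lw: "leaf (h ?w) (h ?c) (h ` insert ?b (insert ?c ?U))"
    by (rule leaf_image[OF h]) (auto simp: fused_iff)
  have lb: "leaf (h ?b) (h ?c) (h ` insert ?c ?U)"
    by (rule leaf_image[OF h]) (auto simp: fused_iff)
  have lc: "leaf (h ?c) (h ?u) (h ` ?U)"
    by (rule leaf_image[OF h]) (auto simp: fused_iff)
  obtain \<alpha>1 \<beta>1 where out1: "end_ear x y (\<alpha>, \<beta>) = (\<alpha>1, \<beta>1)" by fastforce
  obtain \<alpha>2 \<beta>2 where out2: "end_ear x y (1, 1) = (\<alpha>2, \<beta>2)" by fastforce
  have ew: "?ew \<in> sides (h ?w)" "?ew \<in> sides (h ?c)"
    using leaf_common_side[OF lw] by auto
  have eb: "?eb \<in> sides (h ?b)" "?eb \<in> sides (h ?c)"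
    using leaf_common_side[OF lb] by auto
  have eu: "?eu \<in> sides (h ?u)" using leaf_common_side[OF lc] by auto
  note disj = not_fused_no_common_side[OF h]
  have ewb: "?ew \<notin> sides (h ?b)" using disj[OF ew(1), of ?b] by (simp add: fused_iff)
  have ewu: "?ew \<notin> sides (h ?u)" using disj[OF ew(1), of ?u] by (simp add: fused_iff)
  have ebu: "?eb \<notin> sides (h ?u)" using disj[OF eb(1), of ?u] by (simp add: fused_iff)
  obtain f where f: "f \<in> sides (h ?b)" "f \<noteq> ?eb"
    by (rule other_side)
  have "hex_tutte x y (h ` (UNIV \<times> {1..Suc k})) ((\<lambda>_. 1)(g := \<alpha>)) ((\<lambda>_. 1)(g := \<beta>))
      = hex_tutte x y (h ` insert ?b (insert ?c ?U)) ((\<lambda>_. 1)(?ew := \<alpha>1)) ((\<lambda>_. 1)(?ew := \<beta>1))"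
    unfolding split image_insert[of h ?w]
    by (rule remove_end_hexagon[OF xy lw refl g _ out1]) simp
  also have "\<dots> = hex_tutte x y (insert (h ?b) (h ` insert ?c ?U))
      ((\<lambda>_. 1)(?ew := \<alpha>1, f := 1)) ((\<lambda>_. 1)(?ew := \<beta>1, f := 1))"
  proof -
    have "(\<lambda>_. 1)(?ew := c, f := 1) = (\<lambda>_. 1)(?ew := c)" for c :: 'a
      using f ewb by (intro ext) auto
    then show ?thesis by simp
  qed
  also have "\<dots> = hex_tutte x y (h ` insert ?c ?U)
      ((\<lambda>_. 1)(?ew := \<alpha>1, ?eb := \<alpha>2)) ((\<lambda>_. 1)(?ew := \<beta>1, ?eb := \<beta>2))"
    by (rule remove_end_hexagon[OF xy lb refl f _ out2]) (use ewb in auto)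
  also have "\<dots> = hex_tutte x y (h ` ?U) ((\<lambda>_. 1)(?eu := \<alpha>')) ((\<lambda>_. 1)(?eu := \<beta>'))"
    unfolding image_insert[of h ?c]
  proof (rule remove_centre_hexagon[OF xy lc refl ew(2) _ eb(2)])
    show "?ew \<noteq> ?eu" "?eb \<noteq> ?eu" "?ew \<noteq> ?eb" using eu eb ewb ewu ebu by metis+
    show "centre_ear x y (\<alpha>1, \<beta>1) (\<alpha>2, \<beta>2) = (\<alpha>', \<beta>')" using out out1 out2 by simp
  qed simp
  finally show ?thesis .
qed

text \<open>
  The weighted side g of the last hexagon w may be any side not shared with c. In the induction step
  it becomes the side shared with the next unit; that side is none of the sides of c, as the
  hexagons c of one unit and u of the next are not adjacent.
\<close>

lemma hex_tutte_chain:
  fixes x y :: "'a::field"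
  assumes xy: "x \<noteq> 1" "y \<noteq> 1" and "chain_labelling h (Suc k)"
    and "g \<in> sides (h (Hex_w, Suc k))"
      "g \<noteq> corners (h (Hex_w, Suc k)) \<inter> corners (h (Hex_c, Suc k))"
    and "(unit_ear x y ^^ Suc k) (\<alpha>, \<beta>) = (\<alpha>', \<beta>')"
  shows "hex_tutte x y (h ` (UNIV \<times> {1..Suc k})) ((\<lambda>_. 1)(g := \<alpha>)) ((\<lambda>_. 1)(g := \<beta>))
    = (x - 1) * ((x - 1) * \<alpha>' + \<beta>')"
  using assms(3-)
proof (induction k arbitrary: g \<alpha> \<beta>)
  case 0
  let ?c = "(Hex_c, Suc 0)" and ?u = "(Hex_u, Suc 0)"
  let ?eu = "corners (h ?c) \<inter> corners (h ?u)"
  obtain \<alpha>3 \<beta>3 where out: "centre_ear x y (end_ear x y (\<alpha>, \<beta>)) (end_ear x y (1, 1)) = (\<alpha>3, \<beta>3)"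
    by fastforce
  have "leaf (h ?c) (h ?u) (h ` {?u})"
    by (rule leaf_image[OF 0(1)]) (auto simp: fused_iff)
  then have eu: "?eu \<in> sides (h ?u)" by (rule leaf_common_side)
  have "end_ear x y (\<alpha>3, \<beta>3) = (\<alpha>', \<beta>')" using 0(4) out by (simp add: unit_ear_def)
  then show ?case
    unfolding remove_unit[OF xy 0(1-3) out] using hex_tutte_single[OF xy eu] by simp
next
  case (Suc k)
  let ?c = "(Hex_c, Suc (Suc k))" and ?u = "(Hex_u, Suc (Suc k))" and ?w = "(Hex_w, Suc k)"
  let ?eu = "corners (h ?c) \<inter> corners (h ?u)" and ?e = "corners (h ?u) \<inter> corners (h ?w)"
  obtain \<alpha>3 \<beta>3 where out: "centre_ear x y (end_ear x y (\<alpha>, \<beta>)) (end_ear x y (1, 1)) = (\<alpha>3, \<beta>3)"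
    by fastforce
  obtain \<alpha>4 \<beta>4 where out4: "end_ear x y (\<alpha>3, \<beta>3) = (\<alpha>4, \<beta>4)" by fastforce
  have lc: "leaf (h ?c) (h ?u) (h ` insert ?u (UNIV \<times> {1..Suc k}))"
    by (rule leaf_image[OF Suc.prems(1)]) (auto simp: fused_iff)
  have lu: "leaf (h ?u) (h ?w) (h ` (UNIV \<times> {1..Suc k}))"
    by (rule leaf_image[OF Suc.prems(1)]) (auto simp: fused_iff)
  have eu: "?eu \<in> sides (h ?c)" "?eu \<in> sides (h ?u)" using leaf_common_side[OF lc] by auto
  have e: "?e \<in> sides (h ?u)" "?e \<in> sides (h ?w)" using leaf_common_side[OF lu] by auto
  note disj = not_fused_no_common_side[OF Suc.prems(1)]
  have "?eu \<noteq> ?e" using disj[OF eu(1), of ?w] e(2) by (auto simp: fused_iff)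
  have "(unit_ear x y ^^ Suc k) (\<alpha>4, \<beta>4) = (\<alpha>', \<beta>')"
  proof -
    have "unit_ear x y (\<alpha>, \<beta>) = (\<alpha>4, \<beta>4)" using out out4 by (simp add: unit_ear_def)
    then show ?thesis using Suc.prems(4) by (simp add: funpow_Suc_right del: funpow.simps)
  qed
  have "corners (h ?w) \<inter> corners (h (Hex_c, Suc k)) \<in> sides (h (Hex_c, Suc k))"
    using fused_common_side[OF Suc.prems(1), of "(Hex_c, Suc k)" ?w]
    by (simp add: fused_iff Int_commute)
  then have "?e \<noteq> corners (h ?w) \<inter> corners (h (Hex_c, Suc k))"
    using disj[OF e(1), of "(Hex_c, Suc k)"] by (auto simp: fused_iff)
  have "hex_tutte x y (h ` (UNIV \<times> {1..Suc (Suc k)})) ((\<lambda>_. 1)(g := \<alpha>)) ((\<lambda>_. 1)(g := \<beta>))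
      = hex_tutte x y (insert (h ?u) (h ` (UNIV \<times> {1..Suc k})))
          ((\<lambda>_. 1)(?eu := \<alpha>3)) ((\<lambda>_. 1)(?eu := \<beta>3))"
    unfolding remove_unit[OF xy Suc.prems(1-3) out] by simp
  also have "\<dots> = hex_tutte x y (h ` (UNIV \<times> {1..Suc k}))
          ((\<lambda>_. 1)(?e := \<alpha>4)) ((\<lambda>_. 1)(?e := \<beta>4))"
    by (rule remove_end_hexagon[OF xy lu refl eu(2) \<open>?eu \<noteq> ?e\<close> _ out4]) simp
  also have "\<dots> = (x - 1) * ((x - 1) * \<alpha>' + \<beta>')"
    by (rule Suc.IH[OF chain_labelling_mono[OF Suc.prems(1)] e(2)]) (fact | simp)+
  finally show ?case .
qed

lemma tutte_triphenylene_chain: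
  fixes x y :: "'a::field"
  assumes xy: "x \<noteq> 1" "y \<noteq> 1" and H: "triphenylene_chain n H" "n \<ge> 1"
    and out: "(unit_ear x y ^^ n) (1, 1) = (\<alpha>, \<beta>)"
  shows "tutte (hex_graph H) x y = (x - 1) * \<alpha> + \<beta>"
proof -
  obtain h where bij: "bij_betw h (UNIV \<times> {1..n}) H"
    and adj: "\<forall>s\<in>UNIV \<times> {1..n}. \<forall>t\<in>UNIV \<times> {1..n}. adjacent (h s) (h t) \<longleftrightarrow> fused s t \<or> fused t s"
    using H unfolding triphenylene_chain_def by blast
  have benz: "benzenoid_system H" using H unfolding triphenylene_chain_def by blast
  have h: "chain_labelling h n"
    using bij adj benz unfolding chain_labelling_def benzenoid_system_def bij_betw_def by auto
  have HH: "H = h ` (UNIV \<times> {1..n})" using bij by (auto simp: bij_betw_def)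
  obtain k where k: "n = Suc k" using H(2) by (cases n) auto
  let ?e = "corners (h (Hex_w, n)) \<inter> corners (h (Hex_c, n))"
  obtain g where g: "g \<in> sides (h (Hex_w, n))" "g \<noteq> ?e"
    by (rule other_side)
  have "(\<lambda>_. 1)(g := 1) = (\<lambda>_. 1 :: 'a)" by auto
  then have *: "hex_tutte x y H (\<lambda>_. 1) (\<lambda>_. 1) = (x - 1) * ((x - 1) * \<alpha> + \<beta>)"
    using hex_tutte_chain[OF xy, of h k g 1 1 \<alpha> \<beta>] h g out unfolding HH k by simp
  have "finite H" using benz by (simp add: benzenoid_system_def)
  have "tutte (hex_graph H) x y = weighted_tutte x y (verts (hex_graph H)) (edges (hex_graph H))
      (\<lambda>_. 1) (\<lambda>_. 1) / (x - 1)"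
  proof (rule tutte_eq_weighted_tutte[OF xy])
    show "connected_graph (hex_graph H)" using benz by (simp add: benzenoid_system_def)
    fix e assume "e \<in> edges (hex_graph H)"
    then obtain p where "p \<in> H" "e \<in> sides p" by (auto simp: hex_graph_def)
    then show "\<exists>u\<in>verts (hex_graph H). \<exists>v\<in>verts (hex_graph H). e = {u, v}"
      using side_endpoints[of e p] by (auto simp: hex_graph_def)
  qed (use \<open>finite H\<close> in \<open>simp_all add: hex_graph_def\<close>)
  also have "\<dots> = (x - 1) * \<alpha> + \<beta>"
    using * xy by (simp add: hex_graph_def hex_tutte_def)
  finally show ?thesis .
qed

section \<open>Sequences with a second order linear recurrence\<close>

text \<open>
  In terms of the roots of \<open>z\<^sup>2 = t z + d\<close> this is the Lucas sequence with index
  shifted by one, written with the binomial sum of the diagonals of Pascal's triangle.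
\<close>

definition lucas :: "'a::comm_ring_1 \<Rightarrow> 'a \<Rightarrow> nat \<Rightarrow> 'a" where
  "lucas t d n = (\<Sum>j | 2 * j \<le> n. of_nat ((n - j) choose j) * t ^ (n - 2 * j) * d ^ j)"

lemma lucas_eq: "n \<le> m \<Longrightarrow> lucas t d n = (\<Sum>j\<le>m. of_nat ((n - j) choose j) * t ^ (n - 2 * j) * d ^ j)"
  unfolding lucas_def
proof (intro sum.mono_neutral_left ballI)
  fix j assume "j \<in> {..m} - {j. 2 * j \<le> n}"
  then have "(n - j) choose j = 0" by (intro binomial_eq_0) auto
  then show "of_nat ((n - j) choose j) * t ^ (n - 2 * j) * d ^ j = 0"
    by (simp only: of_nat_0 mult_zero_left)
qed auto

lemma lucas_0 [simp]: "lucas t d 0 = 1"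
  by (simp add: lucas_eq[of 0 0])

lemma lucas_1 [simp]: "lucas t d (Suc 0) = t"
  by (simp add: lucas_eq[of "Suc 0" "Suc 0"])

text \<open>
  Pascal's rule, applied to the summands with j > 0.
\<close>

lemma lucas_Suc_Suc: "lucas t d (Suc (Suc n)) = t * lucas t d (Suc n) + d * lucas t d n"
proof -
  let ?f = "\<lambda>n j. of_nat ((n - j) choose j) * t ^ (n - 2 * j) * d ^ j :: 'a"
  have step: "?f (Suc (Suc n)) (Suc j) = t * ?f (Suc n) (Suc j) + d * ?f n j" if "j \<le> n" for j
  proof (cases "2 * j < n")
    case True
    then have "Suc n - j = Suc (n - j)" "n - 2 * j = Suc (n - Suc (2 * j))"
      by auto
    then show ?thesis by (simp add: algebra_simps)
  next
    case False
    then show ?thesis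
    proof (cases "2 * j = n")
      case True
      then have "n - j = j" "Suc n - j = Suc j" by simp_all
      then show ?thesis using True by (simp add: binomial_eq_0)
    qed (simp add: binomial_eq_0)
  qed
  have "lucas t d (Suc (Suc n)) = ?f (Suc (Suc n)) 0 + (\<Sum>j\<le>Suc n. ?f (Suc (Suc n)) (Suc j))"
    by (subst lucas_eq[OF order_refl], subst sum.atMost_Suc_shift) simp
  also have "(\<Sum>j\<le>Suc n. ?f (Suc (Suc n)) (Suc j)) = (\<Sum>j\<le>n. ?f (Suc (Suc n)) (Suc j))"
    by (simp add: binomial_eq_0)
  also have "\<dots> = (\<Sum>j\<le>n. t * ?f (Suc n) (Suc j) + d * ?f n j)"
    by (intro sum.cong refl step) simp
  also have "?f (Suc (Suc n)) 0 + \<dots> = t * (?f (Suc n) 0 + (\<Sum>j\<le>n. ?f (Suc n) (Suc j))) + d * (\<Sum>j\<le>n. ?f n j)"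
    by (simp add: sum.distrib sum_distrib_left distrib_left)
  also have "?f (Suc n) 0 + (\<Sum>j\<le>n. ?f (Suc n) (Suc j)) = lucas t d (Suc n)"
    by (subst lucas_eq[OF order_refl], subst sum.atMost_Suc_shift) simp
  also have "(\<Sum>j\<le>n. ?f n j) = lucas t d n"
    by (subst lucas_eq[OF order_refl]) simp
  finally show ?thesis .
qed

lemma lucas_Binet:
  fixes l1 l2 :: "'a::field"
  assumes "l1 \<noteq> l2"
  shows "(l1 ^ Suc n - l2 ^ Suc n) / (l1 - l2) = lucas (l1 + l2) (- (l1 * l2)) n"
proof (induction n rule: induct_nat_012)
  case (ge2 n)
  have "(l1 ^ Suc (Suc (Suc n)) - l2 ^ Suc (Suc (Suc n)))
      = (l1 + l2) * (l1 ^ Suc (Suc n) - l2 ^ Suc (Suc n)) + - (l1 * l2) * (l1 ^ Suc n - l2 ^ Suc n)"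
    by (simp add: algebra_simps)
  then show ?case
    by (simp only: add_divide_distrib times_divide_eq_right[symmetric] ge2 lucas_Suc_Suc)
qed (use assms in \<open>auto simp: divide_eq_eq algebra_simps power2_eq_square\<close>)

lemma linear_recurrence_lucas:
  assumes rec: "\<And>n. T (Suc (Suc n)) = t * T (Suc n) + d * T n"
  shows "T (Suc (Suc n)) = T (Suc 0) * lucas t d (Suc n) + d * T 0 * lucas t d n"
proof (induction n rule: induct_nat_012)
  case (ge2 n)
  then show ?case by (simp add: rec[of "Suc (Suc n)"] lucas_Suc_Suc[of t d "Suc n"] lucas_Suc_Suc[of t d n] algebra_simps)
qed (simp_all add: rec lucas_Suc_Suc algebra_simps)

section \<open>The transfer matrix of a triphenylene unit\<close>

text \<open>
  Rewrite rules that collect the powers of one variable in a monomial; together with the rules for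
  sums they expand polynomials in two variables to a normal form.
\<close>

lemma monomial_merge:
  fixes x :: "'a::comm_monoid_mult"
  shows "x ^ m * (x ^ n * z) = x ^ (m + n) * z"
  "x * (x ^ n * z) = x ^ (Suc n) * z" "x ^ n * (x * z) = x ^ (Suc n) * z"
  "x * (x * z) = x ^ 2 * z"
  "x * (c * x ^ n) = c * x ^ Suc n" "x ^ m * (c * x ^ n) = c * x ^ (m + n)"
  "x * (c * (d * x ^ n)) = c * (d * x ^ Suc n)" "x ^ m * (c * (d * x ^ n)) = c * (d * x ^ (m + n))"
  "x * (c * (x ^ n * z)) = c * (x ^ Suc n * z)" "x ^ m * (c * (x ^ n * z)) = c * (x ^ (m + n) * z)"
  "x * x = x ^ 2"
  "x * x ^ n = x ^ Suc n" "x ^ n * x = x ^ Suc n"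
  by (simp_all add: power_add mult.left_commute mult.commute mult.assoc power2_eq_square)

text \<open>
  The matrix of \<open>unit_ear\<close>. The pair \<open>(x ^ 4 + R, g)\<close> consists of the
  weights of an edge onto which a plain hexagon is glued, and p, r, s are the coefficients of
  \<open>centre_ear\<close> for this second argument.
\<close>

definition transfer_matrix :: "'a::comm_ring_1 \<Rightarrow> 'a \<Rightarrow> ('a \<times> 'a) \<times> ('a \<times> 'a)" where
  "transfer_matrix x y =
     (let q = x^4; R = 1 + x + x^2 + x^3; g = x^4 + R + y;
          p = x^3 * (x * (x^4 + R) + y); r = x^3 * (x^4 + R) + (1 + x + x^2) * g; s = r + y * g
      in ((q * (q * (p + r) + R * (p + s)),
           q * (p * R + r * (R + y)) + R * (p * R + s * (R + y))),
          (q * (q * (p + r) + (R + y) * (p + s)),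
           q * (p * R + r * (R + y)) + (R + y) * (p * R + s * (R + y)))))"

lemma unit_ear_linear:
  assumes "transfer_matrix x y = ((m11, m12), (m21, m22))"
  shows "unit_ear x y (a, b) = (m11 * a + m12 * b, m21 * a + m22 * b)"
proof -
  define q R g where "q = x^4" and "R = 1 + x + x^2 + x^3" and "g = x^4 + R + y"
  define p r s where "p = x^3 * (x * (x^4 + R) + y)" and "r = x^3 * (x^4 + R) + (1 + x + x^2) * g"
    and "s = r + y * g"
  note defs = q_def R_def g_def p_def r_def s_def
  have e: "end_ear x y (a, b) = (q * a + R * b, q * a + (R + y) * b)" for a b
    by (simp add: end_ear_def q_def R_def)
  have c: "centre_ear x y (a, b) (end_ear x y (1, 1)) = (p * a + r * b, p * a + s * b)" for a b
    unfolding e centre_ear_def Let_def s_def r_def p_def g_def q_def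
    by (simp add: algebra_simps)
  have "transfer_matrix x y =
      ((q * (q * (p + r) + R * (p + s)),
        q * (p * R + r * (R + y)) + R * (p * R + s * (R + y))),
       (q * (q * (p + r) + (R + y) * (p + s)),
        q * (p * R + r * (R + y)) + (R + y) * (p * R + s * (R + y))))"
    unfolding transfer_matrix_def Let_def defs ..
  then have m: "m11 = q * (q * (p + r) + R * (p + s))"
    "m12 = q * (p * R + r * (R + y)) + R * (p * R + s * (R + y))"
    "m21 = q * (q * (p + r) + (R + y) * (p + s))"
    "m22 = q * (p * R + r * (R + y)) + (R + y) * (p * R + s * (R + y))"
    using assms by simp_all
  show ?thesis
    unfolding unit_ear_def e[of a b] c unfolding e m by (simp add: algebra_simps)
qed

text \<open>
  The polynomials I, J, K are the values of the Tutte polynomial when one plain side of u and one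
  plain side of w are both contracted, one deleted and one contracted, or both deleted. In terms of
  M this replaces the first and the last factor of its factorisation by a pair of weights (0, 1) or
  (1, 0). So I, J, K are short expressions in x, y, q, R, p, r, s, and only their agreement with the
  explicit polynomials needs an expansion in x and y. The remaining identities follow from these
  expressions and the relations \<open>q = 1 + (x - 1) R\<close>, \<open>s = r + y g\<close> and
  \<open>p = g + (x - 1) r\<close>.
\<close>

lemma transfer_matrix_identities:
  fixes x y :: "'a::comm_ring_1"
  assumes M: "transfer_matrix x y = ((m11, m12), (m21, m22))"
    and I: "I = y^4 + y^3 * x^4 + 3 * y^3 * x^3 + 4 * y^3 * x^2 + 4 * y^3 * x + 3 * y^3 + 3 * y^2 * x^7
      + 9 * y^2 * x^6 + 15 * y^2 * x^5 + 20 * y^2 * x^4 + 21 * y^2 * x^3 + 15 * y^2 * x^2 + 9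
      * y^2 * x + 3 * y^2 + 2 * y * x^11 + 8 * y * x^10 + 18 * y * x^9 + 32 * y * x^8 + 46 * y
      * x^7 + 53 * y * x^6 + 52 * y * x^5 + 43 * y * x^4 + 28 * y * x^3 + 15 * y * x^2 + 6 * y
      * x + y + x^15 + 4 * x^14 + 10 * x^13 + 20 * x^12 + 33 * x^11 + 46 * x^10 + 56 * x^9 +
      60 * x^8 + 56 * x^7 + 46 * x^6 + 33 * x^5 + 20 * x^4 + 10 * x^3 + 4 * x^2 + x"
    and J: "J = x^4 * (y^3 + y^2 * x^4 + 3 * y^2 * x^3 + 3 * y^2 * x^2 + 3 * y^2 * x + 2 * y^2 + y * x^8
      + 4 * y * x^7 + 7 * y * x^6 + 10 * y * x^5 + 12 * y * x^4 + 10 * y * x^3 + 7 * y * x^2 +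
      4 * y * x + y + x^12 + 3 * x^11 + 6 * x^10 + 10 * x^9 + 14 * x^8 + 16 * x^7 + 16 * x^6 +
      14 * x^5 + 10 * x^4 + 6 * x^3 + 3 * x^2 + x)"
    and K: "K = x^8 * (y + x + (x^4 + x^3 + x^2 + x + y)^2 + x^2 + x^3 + x^4 + x^5 + x^6 + x^7 + x^8 +
      x^9)"
  shows "(x - 1) * (m11 + m12) + (m21 + m22) = I + 2 * J + K"
    and "(m11 + m22) * (x * y - x - y) = (x * y - y - 1) * I - 2 * J + (y - 1) * K"
    and "(m11 * m22 - m12 * m21) * (x * y - x - y) = y * (I * K - J * J)"
proof -
  define q R g where "q = x^4" and "R = 1 + x + x^2 + x^3" and "g = x^4 + R + y"
  define p r s where "p = x^3 * (x * (x^4 + R) + y)" and "r = x^3 * (x^4 + R) + (1 + x + x^2) * g"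
    and "s = r + y * g"
  note defs = q_def R_def g_def p_def r_def s_def
  have "transfer_matrix x y =
      ((q * (q * (p + r) + R * (p + s)),
        q * (p * R + r * (R + y)) + R * (p * R + s * (R + y))),
       (q * (q * (p + r) + (R + y) * (p + s)),
        q * (p * R + r * (R + y)) + (R + y) * (p * R + s * (R + y))))"
    unfolding transfer_matrix_def Let_def defs ..
  then have m: "m11 = q * (q * (p + r) + R * (p + s))"
    "m12 = q * (p * R + r * (R + y)) + R * (p * R + s * (R + y))"
    "m21 = q * (q * (p + r) + (R + y) * (p + s))"
    "m22 = q * (p * R + r * (R + y)) + (R + y) * (p * R + s * (R + y))"
    using M by simp_all
  have IR: "I = q * (p * R + r * (R + y)) + (R + y - 1) * (p * R + s * (R + y))"
    unfolding I s_def r_def p_def q_def unfolding g_def R_def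
    by (simp add: algebra_simps monomial_merge flip: power_add)
  have "x^4 * (p + r) + (R + y - 1) * (p + s) = y^3 + y^2 * x^4 + 3 * y^2 * x^3 + 3 * y^2 * x^2
      + 3 * y^2 * x + 2 * y^2 + y * x^8
      + 4 * y * x^7 + 7 * y * x^6 + 10 * y * x^5 + 12 * y * x^4 + 10 * y * x^3 + 7 * y * x^2 +
      4 * y * x + y + x^12 + 3 * x^11 + 6 * x^10 + 10 * x^9 + 14 * x^8 + 16 * x^7 + 16 * x^6 +
      14 * x^5 + 10 * x^4 + 6 * x^3 + 3 * x^2 + x"
    unfolding s_def r_def p_def unfolding g_def R_def
    by (simp add: algebra_simps monomial_merge flip: power_add)
  then have JR: "J = q * (q * (p + r) + (R + y - 1) * (p + s))"
    unfolding J q_def by simp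
  have "(x - 1) * (p + r) + (p + s) = y + x + (x^4 + x^3 + x^2 + x + y)^2 + x^2 + x^3 + x^4 + x^5
      + x^6 + x^7 + x^8 + x^9"
    unfolding s_def r_def p_def power2_eq_square[of "x^4 + x^3 + x^2 + x + y"] unfolding g_def R_def
    by (simp only: ring_distribs) (simp add: algebra_simps monomial_merge flip: power_add)
  moreover have "x^8 = q * q" unfolding q_def by (simp flip: power_add)
  ultimately have KR: "K = q * q * ((x - 1) * (p + r) + (p + s))"
    unfolding K by simp
  have q: "q = 1 + (x - 1) * R"
    unfolding q_def R_def by (simp add: algebra_simps monomial_merge flip: power_add)
  have p: "p = g + (x - 1) * r"
    unfolding p_def r_def unfolding g_def R_def
    by (simp add: algebra_simps monomial_merge flip: power_add)
  show "(x - 1) * (m11 + m12) + (m21 + m22) = I + 2 * J + K"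
    and "(m11 + m22) * (x * y - x - y) = (x * y - y - 1) * I - 2 * J + (y - 1) * K"
    unfolding m IR JR KR unfolding s_def p unfolding q by (simp_all add: algebra_simps)
  \<comment> \<open>Contracting at u and deleting at w, or the other way round, gives two forms of J. With one
    factor J in each form, I K - J J becomes a product of determinants of 2 by 2 matrices.\<close>
  have JR': "J = q * (x * p * R + ((x - 1) * r + s) * (R + y))"
    unfolding JR s_def p unfolding q by (simp add: algebra_simps)
  have "m11 * m22 - m12 * m21 = (q * y) * (p * (s - r)) * (q * y)"
    unfolding m by (simp add: algebra_simps)
  moreover have "I * K - J * J = q * ((x - 1) * (R + y - 1) - q) * (p * (s - r)) * (q * y)"
    by (subst (2) JR', unfold IR JR KR) (simp add: algebra_simps)
  moreover have "(x - 1) * (R + y - 1) - q = x * y - x - y"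
    unfolding q by (simp add: algebra_simps)
  ultimately show "(m11 * m22 - m12 * m21) * (x * y - x - y) = y * (I * K - J * J)"
    by (simp add: mult_ac)
qed

text \<open>
  The Cayley-Hamilton theorem for the transfer matrix.
\<close>

lemma unit_ear_recurrence:
  assumes M: "transfer_matrix x y = ((m11, m12), (m21, m22))"
  shows "(case (unit_ear x y ^^ Suc (Suc n)) v of (a, b) \<Rightarrow> (x - 1) * a + b)
    = (m11 + m22) * (case (unit_ear x y ^^ Suc n) v of (a, b) \<Rightarrow> (x - 1) * a + b)
      + - (m11 * m22 - m12 * m21) * (case (unit_ear x y ^^ n) v of (a, b) \<Rightarrow> (x - 1) * a + b)"
proof -
  obtain a b where "(unit_ear x y ^^ n) v = (a, b)" by fastforce
  then show ?thesis
    by (simp add: unit_ear_linear[OF M]) (simp add: algebra_simps)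
qed

section \<open>Values of rational expressions in the coefficient field\<close>

text \<open>
  This serves to show that elements are nonzero: the value at one rational point is computed along
  the structure of an expression, which need not be expanded.
\<close>

definition value_at :: "rat \<Rightarrow> rat \<Rightarrow> Qxy_closure \<Rightarrow> rat \<Rightarrow> bool" where
  "value_at u v z c \<longleftrightarrow> (\<exists>P. z = to_ac (Fract P 1) \<and> poly (poly P [:v:]) u = c)"

lemma value_at_nonzero: "value_at u v z c \<Longrightarrow> c \<noteq> 0 \<Longrightarrow> z \<noteq> 0"
  by (auto simp: value_at_def Zero_fract_def eq_fract)

lemma value_at_x: "value_at u v var_x u"
  unfolding value_at_def var_x_def by (intro exI[of _ "[:[:0, 1:]:]"]) simp

lemma value_at_y: "value_at u v var_y v"
  unfolding value_at_def var_y_def by (intro exI[of _ "[:0, 1:]"]) simp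

lemma value_at_1: "value_at u v 1 1"
  unfolding value_at_def by (intro exI[of _ 1]) (simp add: One_fract_def[symmetric])

lemma value_at_add: "value_at u v z c \<Longrightarrow> value_at u v w d \<Longrightarrow> value_at u v (z + w) (c + d)"
  unfolding value_at_def by (force simp flip: to_ac_add)

lemma value_at_diff: "value_at u v z c \<Longrightarrow> value_at u v w d \<Longrightarrow> value_at u v (z - w) (c - d)"
  unfolding value_at_def by (force simp flip: to_ac_diff)

lemma value_at_mult: "value_at u v z c \<Longrightarrow> value_at u v w d \<Longrightarrow> value_at u v (z * w) (c * d)"
  unfolding value_at_def by (force simp flip: to_ac_mult)

lemma value_at_power: "value_at u v z c \<Longrightarrow> value_at u v (z ^ n) (c ^ n)"
  by (induction n) (simp_all add: value_at_1 value_at_mult)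

section \<open>Closed forms\<close>

text \<open>
  In A D - B C one factor xy - x - y cancels against the numerator, since the latter factors as
  \<open>y (xy - x - y) (I K - J\<^sup>2)\<close>.
\<close>

lemma coefficient_identities:
  fixes x y :: "'a::field"
  assumes z: "x * y - x - y \<noteq> 0"
    and A: "A = y * ((x - 1) * I - J) / (x * y - x - y)"
    and C: "C = y * ((x - 1) * (I + J) - (J + K)) / (x * y - x - y)"
    and B: "B = ((y - 1) * J - I) / (x * y - x - y)"
    and D: "D = ((y - 1) * (J + K) - (I + J)) / (x * y - x - y)"
    and t: "t * (x * y - x - y) = (x * y - y - 1) * I - 2 * J + (y - 1) * K"
    and d: "d * (x * y - x - y) = y * (I * K - J * J)"
  shows "A + D = t" and "A * D - B * C = d" and "A * (I + 2 * J + K) - C * (I + J) = d * x"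
proof -
  define w where "w = x * y - x - y"
  have w: "w \<noteq> 0" using z w_def by simp
  have Aw: "A * w = y * ((x - 1) * I - J)" and Bw: "B * w = (y - 1) * J - I"
    and Cw: "C * w = y * ((x - 1) * (I + J) - (J + K))"
    and Dw: "D * w = (y - 1) * (J + K) - (I + J)"
    using w unfolding A B C D w_def by simp_all
  have "(A + D) * w = t * w"
    unfolding distrib_right Aw Dw t[folded w_def] by (simp add: algebra_simps)
  then show "A + D = t" using w by simp
  have "(A * D - B * C) * (w * w) = (A * w) * (D * w) - (B * w) * (C * w)"
    by (simp add: algebra_simps)
  also have "\<dots> = (d * w) * w"
    unfolding Aw Bw Cw Dw d[folded w_def] unfolding w_def by (simp add: algebra_simps)
  finally show "A * D - B * C = d" using w by simp
  have "(A * (I + 2 * J + K) - C * (I + J)) * w = (A * w) * (I + 2 * J + K) - (C * w) * (I + J)"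
    by (simp add: algebra_simps)
  also have "\<dots> = d * w * x"
    unfolding Aw Cw d[folded w_def] by (simp add: algebra_simps)
  finally show "A * (I + 2 * J + K) - C * (I + J) = d * x" using w by simp
qed

theorem corollary4p4:
  fixes n :: nat and H :: "point set"
    and x y I J K A B C D s lam1 lam2 :: Qxy_closure
  assumes "n \<ge> 1" and "triphenylene_chain n H"
    and "x = var_x" and "y = var_y"
    and "I = y^4 + y^3 * x^4 + 3 * y^3 * x^3 + 4 * y^3 * x^2 + 4 * y^3 * x + 3 * y^3 + 3 * y^2 * x^7
      + 9 * y^2 * x^6 + 15 * y^2 * x^5 + 20 * y^2 * x^4 + 21 * y^2 * x^3 + 15 * y^2 * x^2 + 9
      * y^2 * x + 3 * y^2 + 2 * y * x^11 + 8 * y * x^10 + 18 * y * x^9 + 32 * y * x^8 + 46 * y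
      * x^7 + 53 * y * x^6 + 52 * y * x^5 + 43 * y * x^4 + 28 * y * x^3 + 15 * y * x^2 + 6 * y
      * x + y + x^15 + 4 * x^14 + 10 * x^13 + 20 * x^12 + 33 * x^11 + 46 * x^10 + 56 * x^9 +
      60 * x^8 + 56 * x^7 + 46 * x^6 + 33 * x^5 + 20 * x^4 + 10 * x^3 + 4 * x^2 + x"
    and "J = x^4 * (y^3 + y^2 * x^4 + 3 * y^2 * x^3 + 3 * y^2 * x^2 + 3 * y^2 * x + 2 * y^2 + y * x^8
      + 4 * y * x^7 + 7 * y * x^6 + 10 * y * x^5 + 12 * y * x^4 + 10 * y * x^3 + 7 * y * x^2 +
      4 * y * x + y + x^12 + 3 * x^11 + 6 * x^10 + 10 * x^9 + 14 * x^8 + 16 * x^7 + 16 * x^6 +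
      14 * x^5 + 10 * x^4 + 6 * x^3 + 3 * x^2 + x)"
    and "K = x^8 * (y + x + (x^4 + x^3 + x^2 + x + y)^2 + x^2 + x^3 + x^4 + x^5 + x^6 + x^7 + x^8 +
      x^9)"
    and "A = y * ((x - 1) * I - J) / (x * y - x - y)"
    and "C = y * ((x - 1) * (I + J) - (J + K)) / (x * y - x - y)"
    and "B = ((y - 1) * J - I) / (x * y - x - y)"
    and "D = ((y - 1) * (J + K) - (I + J)) / (x * y - x - y)"
    and "s ^ 2 = (A - D) ^ 2 + 4 * B * C"
    and "lam1 = (A + D + s) / 2"
    and "lam2 = (A + D - s) / 2"
  shows "tutte (hex_graph H) x y =
           (I + 2 * J + K) * ((lam1 ^ n - lam2 ^ n) / (lam1 - lam2)) +
           (C * (I + J) - A * (I + 2 * J + K)) * ((lam1 ^ (n - 1) - lam2 ^ (n - 1)) / (lam1 - lam2))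
         \<and>
         tutte (hex_graph H) x y =
           (I + 2 * J + K) *
             (\<Sum>j | int j \<le> (int n - 1) div 2.
                of_nat ((n - j - 1) choose j) * (A + D) ^ (n - 2 * j - 1) * (B * C - A * D) ^ j) +
           (C * (I + J) - A * (I + 2 * J + K)) *
             (\<Sum>j | int j \<le> (int n - 2) div 2.
                of_nat ((n - j - 2) choose j) * (A + D) ^ (n - 2 * j - 2) * (B * C - A * D) ^ j)"
proof -
  let ?T = "\<lambda>n. case (unit_ear x y ^^ n) (1, 1) of (a, b) \<Rightarrow> (x - 1) * a + b"
  obtain m11 m12 m21 m22 where M: "transfer_matrix x y = ((m11, m12), (m21, m22))"
    by (metis surj_pair)
  define t d where "t = m11 + m22" and "d = m11 * m22 - m12 * m21"
  note val = value_at_diff value_at_add value_at_mult value_at_power value_at_1 value_at_x value_at_y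
  have two: "(2::Qxy_closure) \<noteq> 0"
    using value_at_nonzero[OF value_at_add[OF value_at_1 value_at_1]] by simp
  have x: "x \<noteq> 1" and y: "y \<noteq> 1"
    using value_at_nonzero[OF value_at_diff[OF value_at_x[of 0 0] value_at_1]]
      value_at_nonzero[OF value_at_diff[OF value_at_y[of 0 0] value_at_1]] assms(3,4) by auto
  have "value_at 1 0 (x * y - x - y) (1 * 0 - 1 - 0)"
    unfolding assms(3,4) by (intro val)
  then have w: "x * y - x - y \<noteq> 0" by (rule value_at_nonzero) simp
  \<comment> \<open>At x = y = 0 the trace is 1 and the determinant vanishes.\<close>
  have "\<exists>c. value_at 0 0 (t^2 - (d + d + d + d)) c \<and> c \<noteq> 0"
  proof -
    have m: "m11 = fst (fst (transfer_matrix x y))" "m12 = snd (fst (transfer_matrix x y))"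
      "m21 = fst (snd (transfer_matrix x y))" "m22 = snd (snd (transfer_matrix x y))"
      by (simp_all add: M)
    show ?thesis
      unfolding t_def d_def m transfer_matrix_def Let_def fst_conv snd_conv assms(3,4)
      by (rule exI, rule conjI, (rule val)+) simp
  qed
  then have disc: "t^2 - 4 * d \<noteq> 0"
    using value_at_nonzero by fastforce
  note ids = transfer_matrix_identities[OF M assms(5-7), folded t_def d_def]
  note co = coefficient_identities[OF w assms(8,9,10,11) ids(2,3)]
  have s: "s^2 = t^2 - 4 * d"
    unfolding assms(12) co(1,2)[symmetric] by (simp add: algebra_simps power2_eq_square)
  have lam: "lam1 + lam2 = t" "lam1 - lam2 = s" "lam1 * lam2 = d"
  proof -
    show "lam1 + lam2 = t" "lam1 - lam2 = s"
      using two unfolding assms(13,14) co(1) by (simp_all flip: add_divide_distrib diff_divide_distrib)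
    have "4 * (lam1 * lam2) = (2 * lam1) * (2 * lam2)" by simp
    also have "\<dots> = t^2 - s^2"
      using two unfolding assms(13,14) co(1) by (simp add: algebra_simps power2_eq_square)
    also have "\<dots> = 4 * d" unfolding s by simp
    finally have "2 * (2 * (lam1 * lam2 - d)) = 0" by (simp add: algebra_simps)
    then show "lam1 * lam2 = d" using two by (metis eq_iff_diff_eq_0 mult_eq_0_iff)
  qed
  have "lam1 \<noteq> lam2" using lam(2) s disc by auto
  note Binet = lucas_Binet[OF this, unfolded lam(1,3)]
  have bcad: "B * C - A * D = - d" using co(2) by (simp add: algebra_simps)
  have coeff: "C * (I + J) - A * (I + 2 * J + K) = - d * x" using co(3) by (simp add: algebra_simps)
  have T0: "?T 0 = x" by simp
  have T1: "?T (Suc 0) = I + 2 * J + K"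
    using ids(1) by (simp add: unit_ear_linear[OF M] algebra_simps)
  have tutte: "tutte (hex_graph H) x y = ?T n"
    using tutte_triphenylene_chain[OF x y assms(2,1)] by (auto split: prod.split)
  have lucas_int: "(\<Sum>j | int j \<le> int m div 2.
      of_nat ((m - j) choose j) * t ^ (m - 2 * j) * (- d) ^ j) = lucas t (- d) m" for m
  proof -
    have "{j. int j \<le> int m div 2} = {j. 2 * j \<le> m}" by auto
    then show ?thesis by (simp add: lucas_def)
  qed
  show ?thesis
  proof (cases "n = 1")
    case True
    have "{j. int j \<le> -1} = {}" by auto
    then show ?thesis
      using tutte T1 \<open>lam1 \<noteq> lam2\<close> True lucas_int[of 0] unfolding bcad co(1) coeff by simp
  next
    case False
    then obtain k where n: "n = Suc (Suc k)"
      using assms(1) by (metis One_nat_def Suc_le_D not0_implies_Suc)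
    have *: "tutte (hex_graph H) x y = (I + 2 * J + K) * lucas t (- d) (Suc k) + - d * x * lucas t (- d) k"
      using linear_recurrence_lucas[of ?T t "- d" k, OF unit_ear_recurrence[OF M, folded t_def d_def]]
      unfolding T0 T1 tutte n .
    have e: "int n - 1 = int (Suc k)" "int n - 2 = int k" "n - 1 = Suc k"
      "\<And>j. n - j - 1 = Suc k - j" "\<And>j. n - j - 2 = k - j"
      "\<And>j. n - 2 * j - 1 = Suc k - 2 * j" "\<And>j. n - 2 * j - 2 = k - 2 * j"
      unfolding n by auto
    show ?thesis
      unfolding bcad co(1) coeff e lucas_int unfolding n Binet using * by simp
  qed
qed

end
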